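(* Let $A\colon\mathbb{R}\to M_n(\mathbb{R})$ and $f\colon\mathbb{R}\times\mathbb{R}^n\to\mathbb{R}^n$ be continuous. Consider $\dot x=A(t)x$, with transition matrix $X(t,s)$, and $\dot y=A(t)y+f(t,y)$, whose solution with value $\eta$ at time $\tau$ is denoted $t\mapsto y(t,\tau,\eta)$. Assume: (A1) $\sup_{t\in\mathbb{R}}\|A(t)\|=M<+\infty$; (A2) there is $\mu>0$ with $|f(t,y)|\le\mu$ for all $(t,y)\in\mathbb{R}\times\mathbb{R}^n$; (A3) there is $\gamma>0$ with $|f(t,y)-f(t,y')|\le\gamma|y-y'|$ for all $t\in\mathbb{R}$ and $y,y'\in\mathbb{R}^n$; (A4) $\dot x=A(t)x$ has an exponential dichotomy on $\mathbb{R}$ with projection $P=I$ and constants $K,\alpha>0$, that is, $\|X(t,s)\|\le Ke^{-\alpha(t-s)}$ for all $t\ge s$, and $2K\gamma<\alpha$; (D1) for each $t$ the map $y\mapsto f(t,y)$ is $C^2$, and for any fixed $t\in\mathbb{R}$ its first derivative $Df$ with respect to $y$ satisfies $$\int_{-\infty}^{t}\ \sup_{\xi\in\mathbb{R}^n}\|X(t,r)\,Df(r,y(r,0,\xi))\,X(r,t)\|\,dr<1;$$ (D2) for any fixed $t\in\mathbb{R}$ and any $\xi\in\mathbb{R}^n$, $\displaystyle\int_{-\infty}^{t}\mathrm{Tr}\,Df(r,y(r,t,\xi))\,dr<+\infty$. Define $$G(t,\eta)=\eta-\int_{-\infty}^{t}X(t,s)f(s,y(s,t,\eta))\,ds,\qquad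 (t,\eta)\in\mathbb{R}\times\mathbb{R}^n.$$ Then, for any fixed $t\in\mathbb{R}$, the map $\eta\mapsto G(t,\eta)$ is an orientation preserving diffeomorphism of $\mathbb{R}^n$.
   Context: $|\cdot|$ is a norm on $\mathbb{R}^n$ and $\|\cdot\|$ the induced operator norm. If $X(t)$ is a fundamental matrix of $\dot x=A(t)x$, the transition matrix is $X(t,s)=X(t)X^{-1}(s)$. An orientation preserving diffeomorphism of $\mathbb{R}^n$ is a $C^1$ diffeomorphism of $\mathbb{R}^n$ onto itself whose Jacobian determinant is everywhere positive. The map $G$ is the homeomorphism (of Palmer's global linearization) sending solutions of the nonlinear system to solutions of the linear one. *)

theory Defs
  imports "HOL-Analysis.Analysis"
begin

text \<open>The norm on \<open>real ^ 'n\<close> is an arbitrary one, not necessarily the Euclidean type-class norm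
  (the topology, and hence continuity and differentiability, does not depend on the choice).\<close>

definition vector_norm :: "('a::real_vector \<Rightarrow> real) \<Rightarrow> bool" where
  "vector_norm N \<longleftrightarrow>
     (\<forall>x. N x = 0 \<longleftrightarrow> x = 0) \<and>
     (\<forall>c x. N (c *\<^sub>R x) = \<bar>c\<bar> * N x) \<and>
     (\<forall>x y. N (x + y) \<le> N x + N y)"

text \<open>As for the library's \<^const>\<open>onorm\<close>, the quotient at \<open>x = 0\<close> is \<open>0 / 0 = 0\<close>, which does not
  affect the supremum.\<close>

definition operator_norm :: "(real ^ 'n \<Rightarrow> real) \<Rightarrow> real ^ 'n ^ 'n \<Rightarrow> real" where
  "operator_norm N B = (SUP x. N (B *v x) / N x)"

definition fundamental_matrix ::
    "(real \<Rightarrow> real ^ 'n ^ 'n) \<Rightarrow> (real \<Rightarrow> real ^ 'n ^ 'n) \<Rightarrow> bool" where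
  "fundamental_matrix A \<Phi> \<longleftrightarrow>
     (\<forall>t. (\<Phi> has_vector_derivative A t ** \<Phi> t) (at t) \<and> invertible (\<Phi> t))"

definition transition_matrix ::
    "(real \<Rightarrow> real ^ 'n ^ 'n) \<Rightarrow> real \<Rightarrow> real \<Rightarrow> real ^ 'n ^ 'n" where
  "transition_matrix \<Phi> t s = \<Phi> t ** matrix_inv (\<Phi> s)"

text \<open>\<open>y t \<tau> \<eta>\<close> is the value at time \<open>t\<close> of a solution with value \<open>\<eta>\<close> at time \<open>\<tau>\<close>.\<close>

definition solution_flow ::
    "(real \<Rightarrow> 'a::real_normed_vector \<Rightarrow> 'a) \<Rightarrow> (real \<Rightarrow> real \<Rightarrow> 'a \<Rightarrow> 'a) \<Rightarrow> bool" where
  "solution_flow F y \<longleftrightarrow>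
     (\<forall>\<tau> \<eta>. y \<tau> \<tau> \<eta> = \<eta> \<and>
       (\<forall>t. ((\<lambda>t. y t \<tau> \<eta>) has_vector_derivative F t (y t \<tau> \<eta>)) (at t)))"

definition C1_map :: "('a::real_normed_vector \<Rightarrow> 'b::real_normed_vector) \<Rightarrow> bool" where
  "C1_map g \<longleftrightarrow>
     (\<exists>g' :: 'a \<Rightarrow> 'a \<Rightarrow>\<^sub>L 'b.
        (\<forall>x. (g has_derivative blinfun_apply (g' x)) (at x)) \<and> continuous_on UNIV g')"

definition C2_map :: "('a::real_normed_vector \<Rightarrow> 'b::real_normed_vector) \<Rightarrow> bool" where
  "C2_map g \<longleftrightarrow>
     (\<exists>g' :: 'a \<Rightarrow> 'a \<Rightarrow>\<^sub>L 'b.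
        (\<forall>x. (g has_derivative blinfun_apply (g' x)) (at x)) \<and> C1_map g')"

definition C1_diffeomorphism ::
    "('a::real_normed_vector \<Rightarrow> 'b::real_normed_vector) \<Rightarrow> bool" where
  "C1_diffeomorphism g \<longleftrightarrow> bij g \<and> C1_map g \<and> C1_map (inv g)"

definition orientation_preserving_diffeomorphism :: "(real ^ 'n \<Rightarrow> real ^ 'n) \<Rightarrow> bool" where
  "orientation_preserving_diffeomorphism g \<longleftrightarrow>
     C1_diffeomorphism g \<and> (\<forall>x. det (jacobian g (at x)) > 0)"

text \<open>The integral of \<open>g\<close> over \<open>(-\<infinity>, t]\<close> exists, in the improper sense, with the possibly infinite
  value \<open>L\<close>.\<close>

definition has_improper_integral_upto :: "(real \<Rightarrow> real) \<Rightarrow> real \<Rightarrow> ereal \<Rightarrow> bool" where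
  "has_improper_integral_upto g t L \<longleftrightarrow>
     (\<forall>a\<le>t. set_integrable lborel {a..t} g) \<and>
     ((\<lambda>a. ereal (LINT r:{a..t}|lborel. g r)) \<longlongrightarrow> L) at_bot"

definition linearization_map ::
    "(real \<Rightarrow> real ^ 'n ^ 'n) \<Rightarrow> (real \<Rightarrow> real ^ 'n \<Rightarrow> real ^ 'n) \<Rightarrow>
     (real \<Rightarrow> real \<Rightarrow> real ^ 'n \<Rightarrow> real ^ 'n) \<Rightarrow> real \<Rightarrow> real ^ 'n \<Rightarrow> real ^ 'n" where
  "linearization_map \<Phi> f y t \<eta> =
     \<eta> - (LINT s:{..t}|lborel. transition_matrix \<Phi> t s *v f s (y s t \<eta>))"

end

theory Submission
  imports Defs
begin

text \<open>In the moving frame \<open>u(r) = X(t,r) y(r)\<close> the nonlinear equation becomes \<open>u' = F(r,u)\<close> with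
  \<open>F(r,u) = X(t,r) f(r, X(r,t) u)\<close>, and \<open>G(t,u(t))\<close> is the limit of \<open>u\<close> at \<open>-\<infinity>\<close>. Since every
  point is \<open>y(r,0,\<xi>)\<close> for some \<open>\<xi>\<close>, hypothesis (D1) says that \<open>F(r,\<cdot>)\<close> has a Lipschitz constant
  \<open>\<beta>(r)\<close> with \<open>\<integral> \<beta> < 1\<close> over the half-line up to \<open>t\<close>. Hence the integral equation
  \<open>u(r) = c + \<integral> F(s,u(s)) ds\<close> over \<open>s \<le> r\<close> has a unique bounded solution for each initial value
  \<open>c\<close> at \<open>-\<infinity>\<close>, and \<open>H(c) = u(t)\<close> is the inverse of \<open>G(t,\<cdot>)\<close>. The map \<open>H\<close> is \<open>C\<^sup>1\<close> because the
  linearised integral equation \<open>w(r) = v + \<integral> DF(s,u(s)) w(s) ds\<close> is a contraction with the same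
  constant; as \<open>Df\<close> need not be jointly continuous, the remainders are controlled by dominated
  convergence. Estimating backwards from \<open>t\<close> bounds \<open>c\<close> by \<open>u(t)\<close>, so \<open>G(t,\<cdot>)\<close> is Lipschitz and
  \<open>v \<mapsto> w(r)\<close> is invertible for every \<open>r\<close>; its determinant tends to \<open>1\<close> at \<open>-\<infinity>\<close> and is
  therefore positive.\<close>

section \<open>Arbitrary norms on Euclidean space\<close>

lemma vector_norm_zero: "vector_norm N \<Longrightarrow> N x = 0 \<longleftrightarrow> x = 0"
  and vector_norm_scaleR: "vector_norm N \<Longrightarrow> N (c *\<^sub>R x) = \<bar>c\<bar> * N x"
  and vector_norm_triangle: "vector_norm N \<Longrightarrow> N (x + y) \<le> N x + N y"
  by (auto simp: vector_norm_def)

lemma vector_norm_0: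
  assumes "vector_norm N"
  shows "N 0 = 0"
  using vector_norm_zero[OF assms] by simp

lemma vector_norm_minus:
  assumes "vector_norm N"
  shows "N (- x) = N x"
  using vector_norm_scaleR[OF assms, of "-1" x] by simp

lemma vector_norm_nonneg:
  assumes "vector_norm N"
  shows "0 \<le> N x"
  using vector_norm_triangle[OF assms, of x "- x"] vector_norm_minus[OF assms, of x]
    vector_norm_0[OF assms]
  by simp

lemma vector_norm_diff_triangle:
  assumes "vector_norm N"
  shows "N (x - y) \<le> N x + N y"
  using vector_norm_triangle[OF assms, of x "- y"] by (simp add: vector_norm_minus[OF assms])

lemma vector_norm_sum:
  assumes "vector_norm N" "finite I"
  shows "N (\<Sum>i\<in>I. g i) \<le> (\<Sum>i\<in>I. N (g i))"
  using assms(2)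
proof (induction I rule: finite_induct)
  case empty
  then show ?case by (simp add: vector_norm_0[OF assms(1)])
next
  case (insert i I)
  then show ?case using vector_norm_triangle[OF assms(1), of "g i" "sum g I"] by simp
qed

lemma vector_norm_le_norm:
  fixes N :: "'a::euclidean_space \<Rightarrow> real"
  assumes "vector_norm N"
  obtains C where "C > 0" "\<And>x. N x \<le> C * norm x"
proof
  define C where "C = 1 + (\<Sum>i\<in>Basis. N (i::'a))"
  have nn: "0 \<le> (\<Sum>i\<in>Basis. N (i::'a))"
    by (intro sum_nonneg vector_norm_nonneg[OF assms])
  then show "C > 0" by (simp add: C_def)
  show "N x \<le> C * norm x" for x
  proof -
    have "N x = N (\<Sum>i\<in>Basis. (x \<bullet> i) *\<^sub>R i)" by (simp add: euclidean_representation)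
    also have "\<dots> \<le> (\<Sum>i\<in>Basis. N ((x \<bullet> i) *\<^sub>R i))" by (intro vector_norm_sum assms) simp
    also have "\<dots> \<le> (\<Sum>i\<in>Basis. norm x * N i)"
      by (intro sum_mono) (simp add: vector_norm_scaleR[OF assms] mult_right_mono Basis_le_norm
          vector_norm_nonneg[OF assms])
    also have "\<dots> \<le> C * norm x" using nn by (simp add: C_def sum_distrib_left algebra_simps)
    finally show ?thesis .
  qed
qed

lemma continuous_on_vector_norm:
  fixes N :: "'a::euclidean_space \<Rightarrow> real"
  assumes "vector_norm N"
  shows "continuous_on S N"
proof -
  obtain C where C: "C > 0" "\<And>x. N x \<le> C * norm x" using vector_norm_le_norm[OF assms] by blast
  have "dist (N x) (N y) \<le> C * dist x y" for x y
    using vector_norm_triangle[OF assms, of "x - y" y] vector_norm_triangle[OF assms, of "y - x" x]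
      C(2)[of "x - y"] C(2)[of "y - x"]
    by (auto simp: dist_norm norm_minus_commute abs_le_iff)
  then have "C-lipschitz_on S N" using C(1) by (intro lipschitz_onI) auto
  then show ?thesis by (rule lipschitz_on_continuous_on)
qed

lemma borel_measurable_vector_norm:
  fixes N :: "'a::euclidean_space \<Rightarrow> real"
  assumes "vector_norm N" "g \<in> borel_measurable M"
  shows "(\<lambda>x. N (g x)) \<in> borel_measurable M"
  using measurable_compose[OF assms(2) borel_measurable_continuous_onI[OF
      continuous_on_vector_norm[OF assms(1)]]] .

text \<open>By continuity \<open>N\<close> attains a minimum on the Euclidean unit sphere, positive
  by definiteness; homogeneity carries the bound to all vectors.\<close>

lemma norm_le_vector_norm:
  fixes N :: "'a::euclidean_space \<Rightarrow> real"
  assumes "vector_norm N"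
  obtains C where "C > 0" "\<And>x. norm x \<le> C * N x"
proof -
  obtain a :: 'a where a: "a \<in> sphere 0 1" "\<And>x. x \<in> sphere 0 1 \<Longrightarrow> N a \<le> N x"
    using continuous_attains_inf[of "sphere 0 1" N] continuous_on_vector_norm[OF assms]
    by (metis compact_sphere sphere_eq_empty zero_le_one not_less)
  then have "a \<noteq> 0" by auto
  then have pos: "N a > 0"
    using vector_norm_nonneg[OF assms, of a] vector_norm_zero[OF assms, of a] by linarith
  have "norm x \<le> inverse (N a) * N x" for x
  proof (cases "x = 0")
    case False
    then have "N a \<le> N ((1 / norm x) *\<^sub>R x)" by (intro a(2)) simp
    then show ?thesis using False pos by (simp add: vector_norm_scaleR[OF assms] field_simps)
  qed (simp add: vector_norm_0[OF assms])
  then show ?thesis using that[of "inverse (N a)"] pos by auto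
qed

text \<open>A finite-dimensional Hahn-Banach argument: a hyperplane separates \<open>x\<close> from
  the open \<open>N\<close>-ball of radius \<open>N x\<close>, and its normal is rescaled. The
  functional reduces inequalities in \<open>N\<close> to scalar ones without losing a
  constant.\<close>

lemma vector_norm_supporting_functional:
  fixes N :: "'a::euclidean_space \<Rightarrow> real"
  assumes "vector_norm N"
  obtains a where "a \<bullet> x = N x" "\<And>y. a \<bullet> y \<le> N y"
proof (cases "x = 0")
  case True
  then show ?thesis
    by (intro that[of 0]) (simp_all add: vector_norm_0[OF assms] vector_norm_nonneg[OF assms])
next
  case False
  then have Nx: "N x > 0"
    using vector_norm_nonneg[OF assms, of x] vector_norm_zero[OF assms, of x] by linarith
  have "convex {y. N y < N x}"
  proof (rule convexI, safe)
    fix y z :: 'a and u v :: real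
    assume *: "N y < N x" "N z < N x" "0 \<le> u" "0 \<le> v" "u + v = 1"
    have "N (u *\<^sub>R y + v *\<^sub>R z) \<le> u * N y + v * N z"
      using vector_norm_triangle[OF assms, of "u *\<^sub>R y" "v *\<^sub>R z"] *
      by (simp add: vector_norm_scaleR[OF assms])
    also have "\<dots> < N x" using * by (intro convex_bound_lt) auto
    finally show "N (u *\<^sub>R y + v *\<^sub>R z) < N x" .
  qed
  moreover have "0 \<in> {y. N y < N x}" using Nx by (simp add: vector_norm_0[OF assms])
  ultimately obtain a b where a: "a \<noteq> 0" "\<And>y. N y < N x \<Longrightarrow> a \<bullet> y \<le> b" "b \<le> a \<bullet> x"
    using separating_hyperplane_sets[of "{y. N y < N x}" "{x}"] by auto
  \<comment> \<open>Homogeneous form of the separation: \<open>y\<close> is rescaled to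
    \<open>N\<close>-length \<open>\<theta> * N x\<close>, hence into the open ball, and then
    \<theta> tends to 1.\<close>
  have key: "(a \<bullet> y) * N x \<le> (a \<bullet> x) * N y" for y
  proof (cases "y = 0")
    case False
    then have Ny: "N y > 0"
      using vector_norm_nonneg[OF assms, of y] vector_norm_zero[OF assms, of y] by linarith
    have "\<theta> * (N x / N y * (a \<bullet> y)) \<le> a \<bullet> x" if "0 < \<theta>" "\<theta> < 1" for \<theta>
    proof -
      have "N ((\<theta> * N x / N y) *\<^sub>R y) < N x"
        using that Nx Ny by (simp add: vector_norm_scaleR[OF assms])
      from a(2)[OF this] a(3) show ?thesis by simp
    qed
    then have "N x / N y * (a \<bullet> y) \<le> a \<bullet> x" by (rule field_le_mult_one_interval)
    then show ?thesis using Ny by (simp add: field_simps)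
  qed (simp add: vector_norm_0[OF assms])
  \<comment> \<open>Testing \<open>key\<close> at \<open>y = a\<close> makes
    \<open>a \<bullet> x\<close> positive, so the normal can be divided by it.\<close>
  have "a \<bullet> a > 0" using a(1) by simp
  then have "0 < (a \<bullet> x) * N a" using key[of a] Nx by (smt (verit) mult_pos_pos)
  then have ax: "a \<bullet> x > 0" using vector_norm_nonneg[OF assms, of a]
    by (simp add: zero_less_mult_iff)
  show ?thesis
  proof (rule that[of "(N x / (a \<bullet> x)) *\<^sub>R a"])
    show "(N x / (a \<bullet> x)) *\<^sub>R a \<bullet> x = N x" using ax by simp
    show "(N x / (a \<bullet> x)) *\<^sub>R a \<bullet> y \<le> N y" for y
      using key[of y] ax by (simp add: field_simps)
  qed
qed

lemma integrable_vector_norm: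
  fixes N :: "'a::euclidean_space \<Rightarrow> real"
  assumes "vector_norm N" "integrable M g"
  shows "integrable M (\<lambda>x. N (g x))"
proof -
  obtain C where C: "C > 0" "\<And>x. N x \<le> C * norm x" using vector_norm_le_norm[OF assms(1)] by blast
  have "integrable M (\<lambda>x. C * norm (g x))" using assms(2) by simp
  then show ?thesis
  proof (rule Bochner_Integration.integrable_bound)
    show "(\<lambda>x. N (g x)) \<in> borel_measurable M"
      using assms(2) by (intro borel_measurable_vector_norm[OF assms(1)]) simp
    show "AE x in M. norm (N (g x)) \<le> norm (C * norm (g x))"
      using C vector_norm_nonneg[OF assms(1)] by (auto intro: order_trans[OF C(2)])
  qed
qed

text \<open>The functional supporting \<open>N\<close> at the integral is moved under the integral
  sign. Going through the Euclidean norm would cost an equivalence constant and could destroy the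
  strict bound below 1 on which all contractions rest.\<close>

lemma vector_norm_integral_le:
  fixes N :: "'a::euclidean_space \<Rightarrow> real"
  assumes "vector_norm N" "integrable M g"
  shows "N (integral\<^sup>L M g) \<le> (\<integral>x. N (g x) \<partial>M)"
proof -
  obtain a where a: "a \<bullet> integral\<^sup>L M g = N (integral\<^sup>L M g)" "\<And>y. a \<bullet> y \<le> N y"
    using vector_norm_supporting_functional[OF assms(1), of "integral\<^sup>L M g"] by metis
  have "a \<bullet> integral\<^sup>L M g = (\<integral>x. a \<bullet> g x \<partial>M)" using assms(2) by simp
  also have "\<dots> \<le> (\<integral>x. N (g x) \<partial>M)"
  proof (rule integral_mono)
    show "integrable M (\<lambda>x. a \<bullet> g x)" using assms(2) by simp
    show "integrable M (\<lambda>x. N (g x))" by (rule integrable_vector_norm[OF assms])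
  qed (rule a(2))
  finally show ?thesis using a(1) by simp
qed

text \<open>The scalar mean value theorem along the segment, applied to \<open>g\<close> tested
  against the functional supporting \<open>N\<close> at \<open>g x - g y\<close>; the constant
  \<open>B\<close> is kept exactly.\<close>

lemma vector_norm_differentiable_bound:
  fixes N :: "'a::euclidean_space \<Rightarrow> real" and g :: "'a \<Rightarrow> 'a"
  assumes "vector_norm N" and der: "\<And>z. (g has_derivative g' z) (at z)"
    and bound: "\<And>z v. N (g' z v) \<le> B * N v"
  shows "N (g x - g y) \<le> B * N (x - y)"
proof -
  obtain a where a: "a \<bullet> (g x - g y) = N (g x - g y)" "\<And>z. a \<bullet> z \<le> N z"
    using vector_norm_supporting_functional[OF assms(1), of "g x - g y"] by metis
  define h where "h = (\<lambda>\<theta>::real. a \<bullet> g (y + \<theta> *\<^sub>R (x - y)))"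
  have h: "(h has_derivative (\<lambda>\<delta>. a \<bullet> g' (y + \<theta> *\<^sub>R (x - y)) (\<delta> *\<^sub>R (x - y)))) (at \<theta>)" for \<theta>
    unfolding h_def
    by (intro has_derivative_inner_right has_derivative_compose[OF _ der])
      (auto intro!: derivative_eq_intros)
  have "\<exists>\<theta>\<in>{0<..<1}. h 1 - h 0 = a \<bullet> g' (y + \<theta> *\<^sub>R (x - y)) ((1 - 0) *\<^sub>R (x - y))"
    using mvt_simple[of 0 1 h "\<lambda>\<theta> \<delta>. a \<bullet> g' (y + \<theta> *\<^sub>R (x - y)) (\<delta> *\<^sub>R (x - y))"]
      has_derivative_at_withinI[OF h] by simp
  then obtain \<theta> where "h 1 - h 0 = a \<bullet> g' (y + \<theta> *\<^sub>R (x - y)) (x - y)" by auto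
  moreover have "h 1 - h 0 = N (g x - g y)" using a(1) by (simp add: h_def inner_diff_right)
  ultimately show ?thesis using order_trans[OF a(2) bound] by simp
qed

section \<open>Integral equations on the half-lines\<close>

lemma set_integrable_lborel:
  fixes g :: "real \<Rightarrow> 'a::euclidean_space"
  assumes "integrable lborel g" "A \<in> sets borel"
  shows "set_integrable lborel A g"
  using integrable_mult_indicator[OF _ assms(1), of A] assms(2) by (simp add: set_integrable_def)

lemma continuous_on_LINT_atMost:
  fixes g :: "real \<Rightarrow> 'a::euclidean_space"
  assumes "integrable lborel g"
  shows "continuous_on UNIV (\<lambda>r. LINT s:{..r}|lborel. g s)"
proof (rule continuous_at_imp_continuous_on, safe)
  fix r :: real
  show "isCont (\<lambda>r. LINT s:{..r}|lborel. g s) r"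
    unfolding continuous_at_sequentially comp_def set_lebesgue_integral_def
  proof (safe, rule integral_dominated_convergence)
    fix X :: "nat \<Rightarrow> real" assume X: "X \<longlonglongrightarrow> r"
    show "(\<lambda>s. indicator {..r} s *\<^sub>R g s) \<in> borel_measurable lborel"
      "\<And>i. (\<lambda>s. indicator {..X i} s *\<^sub>R g s) \<in> borel_measurable lborel"
      using assms by auto
    show "integrable lborel (\<lambda>s. norm (g s))" using assms by simp
    show "AE s in lborel. norm (indicator {..X i} s *\<^sub>R g s) \<le> norm (g s)" for i
      by (auto simp: indicator_def)
    \<comment> \<open>The indicators converge except possibly at \<open>s = r\<close>, a null
      set.\<close>
    show "AE s in lborel. (\<lambda>i. indicator {..X i} s *\<^sub>R g s) \<longlonglongrightarrow> indicator {..r} s *\<^sub>R g s"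
      using AE_lborel_singleton[of r]
    proof eventually_elim
      case (elim s)
      then consider "s < r" | "r < s" by linarith
      then have "\<forall>\<^sub>F i in sequentially. indicator {..X i} s *\<^sub>R g s = indicator {..r} s *\<^sub>R g s"
      proof cases
        case 1
        then show ?thesis using order_tendstoD(1)[OF X 1] by (auto elim!: eventually_mono)
      next
        case 2
        then show ?thesis using order_tendstoD(2)[OF X 2] by (auto elim!: eventually_mono)
      qed
      then show ?case by (rule tendsto_eventually)
    qed
  qed
qed

text \<open>Identifies \<open>c\<close> in \<open>c + (LINT s:{..r}|lborel. g s)\<close> as the
  value at -\<infinity>, along a sequence as dominated convergence requires.\<close>

lemma tendsto_LINT_atMost_at_bot:
  fixes g :: "real \<Rightarrow> 'a::euclidean_space"
  assumes "integrable lborel g"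
  shows "(\<lambda>n. LINT s:{..- real n}|lborel. g s) \<longlonglongrightarrow> 0"
proof -
  have "(\<lambda>n. \<integral>s. indicator {..- real n} s *\<^sub>R g s \<partial>lborel) \<longlonglongrightarrow> (\<integral>s. 0 \<partial>(lborel :: real measure))"
  proof (rule integral_dominated_convergence)
    show "integrable lborel (\<lambda>s. norm (g s))" using assms by simp
    show "AE s in lborel. (\<lambda>n. indicator {..- real n} s *\<^sub>R g s) \<longlonglongrightarrow> 0"
    proof
      fix s :: real
      obtain m :: nat where "- s < m" using reals_Archimedean2 by blast
      then have "\<forall>\<^sub>F n in sequentially. indicator {..- real n} s *\<^sub>R g s = 0"
        unfolding eventually_sequentially by (intro exI[of _ m]) auto
      then show "(\<lambda>n. indicator {..- real n} s *\<^sub>R g s) \<longlonglongrightarrow> 0" by (rule tendsto_eventually)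
    qed
    show "AE s in lborel. norm (indicator {..- real n} s *\<^sub>R g s) \<le> norm (g s)" for n
      by (auto simp: indicator_def)
  qed (use assms in auto)
  then show ?thesis by (simp add: set_lebesgue_integral_def)
qed

lemma norm_set_lebesgue_integral_le:
  fixes g :: "real \<Rightarrow> 'a::euclidean_space"
  assumes "integrable lborel g" "A \<in> sets borel"
  shows "norm (LINT s:A|lborel. g s) \<le> (\<integral>s. norm (g s) \<partial>lborel)"
proof -
  have "norm (LINT s:A|lborel. g s) \<le> (\<integral>s. norm (indicator A s *\<^sub>R g s) \<partial>lborel)"
    unfolding set_lebesgue_integral_def by (rule integral_norm_bound)
  also have "\<dots> \<le> (\<integral>s. norm (g s) \<partial>lborel)"
  proof (rule integral_mono)
    show "integrable lborel (\<lambda>s. norm (indicator A s *\<^sub>R g s))"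
      using set_integrable_lborel[OF assms] unfolding set_integrable_def by (rule integrable_norm)
  qed (use assms in \<open>auto simp: indicator_def\<close>)
  finally show ?thesis .
qed

lemma bounded_LINT_atMost:
  fixes g :: "real \<Rightarrow> 'a::euclidean_space"
  assumes "integrable lborel g"
  shows "bounded (range (\<lambda>r. c + (LINT s:{..r}|lborel. g s)))"
proof -
  have "norm (c + (LINT s:{..r}|lborel. g s)) \<le> norm c + (\<integral>s. norm (g s) \<partial>lborel)" for r
    using norm_set_lebesgue_integral_le[OF assms, of "{..r}"]
      norm_triangle_ineq[of c "LINT s:{..r}|lborel. g s"] by simp
  then show ?thesis by (auto simp: bounded_iff)
qed

text \<open>An initial value problem posed at -\<infinity>, in integrated form because the
  linearised right-hand side is only measurable in time. Boundedness gives integrability of the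
  integrand for the equations considered; without it the integral could take its default value
  0.\<close>

definition solves_from_bot ::
    "(real \<Rightarrow> 'a::euclidean_space \<Rightarrow> 'a) \<Rightarrow> 'a \<Rightarrow> (real \<Rightarrow> 'a) \<Rightarrow> bool" where
  "solves_from_bot \<Psi> c u \<longleftrightarrow> continuous_on UNIV u \<and> bounded (range u) \<and>
     (\<forall>r. u r = c + (LINT s:{..r}|lborel. \<Psi> s (u s)))"

lemma solves_from_bot_continuous: "solves_from_bot \<Psi> c u \<Longrightarrow> continuous_on UNIV u"
  and solves_from_bot_bounded: "solves_from_bot \<Psi> c u \<Longrightarrow> bounded (range u)"
  and solves_from_bot_eq: "solves_from_bot \<Psi> c u \<Longrightarrow> u r = c + (LINT s:{..r}|lborel. \<Psi> s (u s))"
  unfolding solves_from_bot_def by blast+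

section \<open>Integral equations with a Lipschitz kernel of total mass below 1\<close>

locale contractive_kernel =
  fixes N :: "'a::euclidean_space \<Rightarrow> real" and \<beta> :: "real \<Rightarrow> real"
  assumes vn: "vector_norm N"
    and beta_integrable: "integrable lborel \<beta>"
    and beta_nonneg: "\<And>s. 0 \<le> \<beta> s"
    and beta_less_1: "(\<integral>s. \<beta> s \<partial>lborel) < 1"
begin

definition b :: real where "b = (\<integral>s. \<beta> s \<partial>lborel)"

lemma b_nonneg: "0 \<le> b" and b_less_1: "b < 1"
  using beta_less_1 by (auto simp: b_def beta_nonneg)

text \<open>Measurability is asked along continuous curves, a form that survives passing from a map
  to its directional derivatives. The Lipschitz bound holds almost everywhere because the kernel
  will come from a supremum that is finite only almost everywhere.\<close>

definition admissible :: "(real \<Rightarrow> 'a \<Rightarrow> 'a) \<Rightarrow> bool" where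
  "admissible \<Psi> \<longleftrightarrow>
     (\<forall>u. continuous_on UNIV u \<longrightarrow> (\<lambda>s. \<Psi> s (u s)) \<in> borel_measurable borel) \<and>
     integrable lborel (\<lambda>s. \<Psi> s 0) \<and>
     (AE s in lborel. \<forall>x y. N (\<Psi> s x - \<Psi> s y) \<le> \<beta> s * N (x - y))"

lemma bounded_vector_norm:
  assumes "bounded (range p)"
  obtains S where "0 \<le> S" "\<And>s. N (p s) \<le> S"
proof -
  obtain C where C: "C > 0" "\<And>x. N x \<le> C * norm x" using vector_norm_le_norm[OF vn] by blast
  obtain B where B: "\<And>s. norm (p s) \<le> B" using assms by (auto simp: bounded_iff)
  have "N (p s) \<le> C * B" for s
    using C(2)[of "p s"] mult_left_mono[OF B[of s], of C] C(1) by linarith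
  moreover from this have "0 \<le> C * B" using vector_norm_nonneg[OF vn] order_trans by blast
  ultimately show ?thesis using that by blast
qed

text \<open>The supremum \<open>S\<close> of \<open>N\<close> along \<open>p\<close> over
  \<open>T\<close> is finite, so \<open>S \<le> C + b * S\<close> can be solved for
  \<open>S\<close>. The set \<open>T\<close> is the whole line in the forward estimate and a
  half-line in the backward one.\<close>

lemma absorb:
  assumes "bounded (range p)" "r \<in> T"
    and step: "\<And>S r. \<lbrakk>0 \<le> S; r \<in> T; \<And>s. s \<in> T \<Longrightarrow> N (p s) \<le> S\<rbrakk> \<Longrightarrow> N (p r) \<le> C + b * S"
  shows "N (p r) \<le> C / (1 - b)"
proof -
  define S where "S = (SUP s\<in>T. N (p s))"
  obtain S0 where S0: "\<And>s. N (p s) \<le> S0" using bounded_vector_norm[OF assms(1)] by blast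
  have S: "N (p s) \<le> S" if "s \<in> T" for s
    unfolding S_def using that S0 by (intro cSUP_upper) (auto simp: bdd_above_def)
  then have "0 \<le> S" using vector_norm_nonneg[OF vn, of "p r"] assms(2) order_trans by blast
  have "S \<le> C + b * S"
    unfolding S_def
  proof (rule cSUP_least)
    fix s assume "s \<in> T"
    then show "N (p s) \<le> C + b * (SUP s\<in>T. N (p s))"
      using step[OF \<open>0 \<le> S\<close> \<open>s \<in> T\<close> S] by (simp add: S_def)
  qed (use assms(2) in blast)
  then have "S \<le> C / (1 - b)" using b_less_1 by (simp add: field_simps)
  then show ?thesis using S[OF assms(2)] by linarith
qed

lemma vector_norm_LINT_le:
  assumes "integrable lborel g" "A \<in> sets borel" "integrable lborel k" "\<And>s. 0 \<le> k s" "0 \<le> S"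
    and "AE s in lborel. s \<in> A \<longrightarrow> N (g s) \<le> \<beta> s * S + k s"
  shows "N (LINT s:A|lborel. g s) \<le> b * S + (\<integral>s. k s \<partial>lborel)"
proof -
  have int: "integrable lborel (\<lambda>s. indicator A s *\<^sub>R g s)"
    using set_integrable_lborel[OF assms(1,2)] by (simp add: set_integrable_def)
  have "N (LINT s:A|lborel. g s) \<le> (\<integral>s. N (indicator A s *\<^sub>R g s) \<partial>lborel)"
    unfolding set_lebesgue_integral_def by (rule vector_norm_integral_le[OF vn int])
  also have "\<dots> \<le> (\<integral>s. \<beta> s * S + k s \<partial>lborel)"
  proof (rule integral_mono_AE)
    show "integrable lborel (\<lambda>s. N (indicator A s *\<^sub>R g s))" by (rule integrable_vector_norm[OF vn int])
    show "integrable lborel (\<lambda>s. \<beta> s * S + k s)" using assms(3) beta_integrable by simp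
    show "AE s in lborel. N (indicator A s *\<^sub>R g s) \<le> \<beta> s * S + k s"
      using assms(6) by eventually_elim
        (auto simp: indicator_def vector_norm_0[OF vn] assms(4,5) beta_nonneg)
  qed
  also have "\<dots> = b * S + (\<integral>s. k s \<partial>lborel)" using assms(3) beta_integrable by (simp add: b_def)
  finally show ?thesis .
qed

text \<open>A substitute for Gronwall: the kernel part of the integral is at most \<open>b\<close>
  times the supremum of \<open>N (p s)\<close> and is absorbed. The term \<open>k\<close>
  accommodates equations that hold only up to an integrable error.\<close>

lemma forward_estimate:
  assumes "bounded (range p)" "integrable lborel g" "integrable lborel k" "\<And>s. 0 \<le> k s"
    and p: "\<And>r. p r = c + (LINT s:{..r}|lborel. g s)"
    and g: "AE s in lborel. N (g s) \<le> \<beta> s * N (p s) + k s"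
  shows "N (p r) \<le> (N c + (\<integral>s. k s \<partial>lborel)) / (1 - b)"
proof (rule absorb[OF assms(1)])
  show "r \<in> UNIV" by simp
  fix S r assume S: "0 \<le> S" "\<And>s. s \<in> UNIV \<Longrightarrow> N (p s) \<le> S"
  have "N (LINT s:{..r}|lborel. g s) \<le> b * S + (\<integral>s. k s \<partial>lborel)"
  proof (rule vector_norm_LINT_le[OF assms(2) _ assms(3,4) S(1)])
    show "AE s in lborel. s \<in> {..r} \<longrightarrow> N (g s) \<le> \<beta> s * S + k s"
      using g
    proof eventually_elim
      case (elim s)
      then show ?case using mult_left_mono[OF S(2)[of s] beta_nonneg[of s]] by simp
    qed
  qed simp
  then show "N (p r) \<le> N c + (\<integral>s. k s \<partial>lborel) + b * S"
    using vector_norm_triangle[OF vn, of c "LINT s:{..r}|lborel. g s"] by (simp add: p[of r])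
qed

text \<open>Integrating backwards from \<open>t\<close>, absorption on \<open>{..t}\<close> bounds
  \<open>p\<close> there by \<open>N (p t) / (1 - b)\<close>. Then \<open>c\<close> is
  \<open>p t\<close> minus the whole integral, and
  \<open>1 + b / (1 - b) = 1 / (1 - b)\<close>.\<close>

lemma backward_estimate:
  assumes "bounded (range p)" "integrable lborel g"
    and p: "\<And>r. p r = c + (LINT s:{..r}|lborel. g s)"
    and g: "AE s in lborel. N (g s) \<le> \<beta> s * N (p s)"
  shows "N c \<le> N (p t) / (1 - b)"
proof -
  \<comment> \<open>Stated for a general \<open>A\<close>, since it serves both
    \<open>{r<..t}\<close> and the full half-line \<open>{..t}\<close>.\<close>
  have bd: "N (LINT s:A|lborel. g s) \<le> b * S"
    if "A \<in> sets borel" "A \<subseteq> {..t}" "0 \<le> S" "\<And>s. s \<le> t \<Longrightarrow> N (p s) \<le> S" for A S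
  proof -
    have "AE s in lborel. s \<in> A \<longrightarrow> N (g s) \<le> \<beta> s * S + 0"
      using g
    proof eventually_elim
      case (elim s)
      show ?case
      proof
        assume "s \<in> A"
        with that(2,4) have "N (p s) \<le> S" by auto
        with elim show "N (g s) \<le> \<beta> s * S + 0"
          using mult_left_mono[OF _ beta_nonneg[of s]] by fastforce
      qed
    qed
    from vector_norm_LINT_le[OF assms(2) that(1) _ _ that(3) this] show ?thesis by simp
  qed
  have diff: "p s = p t - (LINT s:{s<..t}|lborel. g s)" if "s \<le> t" for s
  proof -
    have "(LINT s:{..s} \<union> {s<..t}|lborel. g s) =
        (LINT s:{..s}|lborel. g s) + (LINT s:{s<..t}|lborel. g s)"
      by (intro set_integral_Un set_integrable_lborel[OF assms(2)]) auto
    moreover have "{..s} \<union> {s<..t} = {..t}" using that by auto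
    ultimately show ?thesis by (simp add: p)
  qed
  have pt: "N (p s) \<le> N (p t) / (1 - b)" if "s \<le> t" for s
  proof (rule absorb[OF assms(1)])
    show "s \<in> {..t}" using that by simp
    fix S r assume S: "0 \<le> S" "r \<in> {..t}" "\<And>s. s \<in> {..t} \<Longrightarrow> N (p s) \<le> S"
    have "N (LINT s:{r<..t}|lborel. g s) \<le> b * S" using S by (intro bd) auto
    then show "N (p r) \<le> N (p t) + b * S"
      using vector_norm_diff_triangle[OF vn, of "p t" "LINT s:{r<..t}|lborel. g s"] diff[of r] S(2)
      by simp
  qed
  have "N (LINT s:{..t}|lborel. g s) \<le> b * (N (p t) / (1 - b))"
    using pt vector_norm_nonneg[OF vn] b_less_1 by (intro bd) auto
  then have "N c \<le> N (p t) + b * (N (p t) / (1 - b))"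
    using vector_norm_diff_triangle[OF vn, of "p t" "LINT s:{..t}|lborel. g s"] by (simp add: p[of t])
  also have "\<dots> = N (p t) / (1 - b)" using b_less_1 by (simp add: field_simps)
  finally show ?thesis .
qed

lemma admissible_measurable:
  "admissible \<Psi> \<Longrightarrow> continuous_on UNIV u \<Longrightarrow> (\<lambda>s. \<Psi> s (u s)) \<in> borel_measurable borel"
  and admissible_integrable_0: "admissible \<Psi> \<Longrightarrow> integrable lborel (\<lambda>s. \<Psi> s 0)"
  and admissible_lipschitz:
    "admissible \<Psi> \<Longrightarrow> AE s in lborel. \<forall>x y. N (\<Psi> s x - \<Psi> s y) \<le> \<beta> s * N (x - y)"
  by (auto simp: admissible_def)

lemma admissible_integrable:
  assumes adm: "admissible \<Psi>" and u: "continuous_on UNIV u" "bounded (range u)"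
  shows "integrable lborel (\<lambda>s. \<Psi> s (u s))"
proof -
  obtain C where C: "C > 0" "\<And>x. norm x \<le> C * N x" using norm_le_vector_norm[OF vn] by blast
  obtain S where S: "0 \<le> S" "\<And>s. N (u s) \<le> S" using bounded_vector_norm[OF u(2)] by blast
  have "integrable lborel (\<lambda>s. norm (\<Psi> s 0) + C * (\<beta> s * S))"
    using admissible_integrable_0[OF adm] beta_integrable by simp
  then show ?thesis
  proof (rule Bochner_Integration.integrable_bound)
    show "(\<lambda>s. \<Psi> s (u s)) \<in> borel_measurable lborel" using admissible_measurable[OF adm u(1)] by simp
    show "AE s in lborel. norm (\<Psi> s (u s)) \<le> norm (norm (\<Psi> s 0) + C * (\<beta> s * S))"
      using admissible_lipschitz[OF adm]
    proof eventually_elim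
      case (elim s)
      have "norm (\<Psi> s (u s)) \<le> norm (\<Psi> s 0) + norm (\<Psi> s (u s) - \<Psi> s 0)"
        using norm_triangle_ineq[of "\<Psi> s 0" "\<Psi> s (u s) - \<Psi> s 0"] by simp
      also have "norm (\<Psi> s (u s) - \<Psi> s 0) \<le> C * N (\<Psi> s (u s) - \<Psi> s 0)" by (rule C(2))
      also have "N (\<Psi> s (u s) - \<Psi> s 0) \<le> \<beta> s * N (u s)" using elim[rule_format, of "u s" 0] by simp
      also have "N (u s) \<le> S" by (rule S(2))
      finally show ?case using C(1) beta_nonneg S(1) by (simp add: mult_left_mono)
    qed
  qed
qed

text \<open>The difference of two solutions satisfies both estimates with no error term. The first
  half yields uniqueness and Lipschitz dependence on the value at -\<infinity>; the second makes the
  inverse dependence Lipschitz.\<close>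

lemma solves_from_bot_estimate:
  assumes adm: "admissible \<Psi>" and u: "solves_from_bot \<Psi> c u" and v: "solves_from_bot \<Psi> d v"
  shows "N (u r - v r) \<le> N (c - d) / (1 - b)" and "N (c - d) \<le> N (u r - v r) / (1 - b)"
proof -
  let ?g = "\<lambda>s. \<Psi> s (u s) - \<Psi> s (v s)"
  note uv = solves_from_bot_continuous[OF u] solves_from_bot_bounded[OF u]
    solves_from_bot_continuous[OF v] solves_from_bot_bounded[OF v]
  have int: "integrable lborel (\<lambda>s. \<Psi> s (u s))" "integrable lborel (\<lambda>s. \<Psi> s (v s))"
    by (rule admissible_integrable[OF adm uv(1,2)], rule admissible_integrable[OF adm uv(3,4)])
  have bnd: "bounded (range (\<lambda>s. u s - v s))" using bounded_minus_comp[OF uv(2,4)] by simp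
  have eq: "u r - v r = (c - d) + (LINT s:{..r}|lborel. ?g s)" for r
    by (simp add: solves_from_bot_eq[OF u, of r] solves_from_bot_eq[OF v, of r]
        set_integral_diff(2)[OF set_integrable_lborel[OF int(1)] set_integrable_lborel[OF int(2)]])
  have lip: "AE s in lborel. N (?g s) \<le> \<beta> s * N (u s - v s)"
    using admissible_lipschitz[OF adm] by eventually_elim blast
  show "N (u r - v r) \<le> N (c - d) / (1 - b)"
    using forward_estimate[OF bnd, of ?g "\<lambda>_. 0" "c - d" r] int eq lip by simp
  show "N (c - d) \<le> N (u r - v r) / (1 - b)"
    using backward_estimate[OF bnd, of ?g "c - d" r] int eq lip by simp
qed

lemma solves_from_bot_unique:
  assumes "admissible \<Psi>" "solves_from_bot \<Psi> c u" "solves_from_bot \<Psi> c v"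
  shows "u = v"
proof
  fix r
  have "N (u r - v r) \<le> 0"
    using solves_from_bot_estimate(1)[OF assms, of r] by (simp add: vector_norm_0[OF vn])
  then have "N (u r - v r) = 0" using vector_norm_nonneg[OF vn, of "u r - v r"] by linarith
  then show "u r = v r" by (simp add: vector_norm_zero[OF vn])
qed

text \<open>Banach's theorem on bounded continuous functions. The integral operator \<open>T\<close>
  contracts by \<open>b\<close> in the supremum of \<open>N\<close>, but the metric of the function
  space is Euclidean, so a power of \<open>T\<close> is used to beat the equivalence
  constants.\<close>

lemma solves_from_bot_exists:
  assumes adm: "admissible \<Psi>"
  obtains u where "solves_from_bot \<Psi> c u"
proof -
  define T where "T = (\<lambda>u::real \<Rightarrow>\<^sub>C 'a.
    Bcontfun (\<lambda>r. c + (LINT s:{..r}|lborel. \<Psi> s (apply_bcontfun u s))))"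
  have int: "integrable lborel (\<lambda>s. \<Psi> s (apply_bcontfun u s))" for u :: "real \<Rightarrow>\<^sub>C 'a"
    by (rule admissible_integrable[OF adm continuous_on_apply_bcontfun bounded_apply_bcontfun])
  have T: "apply_bcontfun (T u) r = c + (LINT s:{..r}|lborel. \<Psi> s (apply_bcontfun u s))" for u r
  proof -
    have "(\<lambda>r. c + (LINT s:{..r}|lborel. \<Psi> s (apply_bcontfun u s))) \<in> bcontfun"
      using bounded_LINT_atMost[OF int] continuous_on_LINT_atMost[OF int]
      by (auto simp: bcontfun_def intro!: continuous_intros)
    then show ?thesis by (simp add: T_def Bcontfun_inverse)
  qed
  have step: "N (apply_bcontfun (T u) r - apply_bcontfun (T v) r) \<le> b * S"
    if "0 \<le> S" "\<And>r. N (apply_bcontfun u r - apply_bcontfun v r) \<le> S" for u v S r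
  proof -
    have "N (LINT s:{..r}|lborel. \<Psi> s (apply_bcontfun u s) - \<Psi> s (apply_bcontfun v s)) \<le> b * S + (\<integral>s. 0 \<partial>(lborel::real measure))"
    proof (rule vector_norm_LINT_le)
      show "AE s in lborel. s \<in> {..r} \<longrightarrow>
          N (\<Psi> s (apply_bcontfun u s) - \<Psi> s (apply_bcontfun v s)) \<le> \<beta> s * S + 0"
        using admissible_lipschitz[OF adm]
      proof eventually_elim
        case (elim s)
        then show ?case
          using mult_left_mono[OF that(2)[of s] beta_nonneg[of s]] by (auto intro: order_trans)
      qed
    qed (use int that(1) in auto)
    then show ?thesis
      by (simp add: T set_integral_diff(2)[OF set_integrable_lborel[OF int] set_integrable_lborel[OF int]])
  qed
  obtain C1 where C1: "C1 > 0" "\<And>x. norm x \<le> C1 * N x" using norm_le_vector_norm[OF vn] by blast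
  obtain C2 where C2: "C2 > 0" "\<And>x. N x \<le> C2 * norm x" using vector_norm_le_norm[OF vn] by blast
  have iter: "N (apply_bcontfun ((T ^^ m) u) r - apply_bcontfun ((T ^^ m) v) r) \<le> b ^ m * (C2 * dist u v)"
    for m u v r
  proof (induction m arbitrary: r)
    case 0
    have "norm (apply_bcontfun u r - apply_bcontfun v r) \<le> dist u v"
      using dist_bounded[of u r v] by (simp add: dist_norm)
    then show ?case
      using C2(2)[of "apply_bcontfun u r - apply_bcontfun v r"] C2(1)
      by (auto intro: order_trans mult_left_mono)
  next
    case (Suc m)
    have "0 \<le> b ^ m * (C2 * dist u v)" using b_nonneg C2(1) by simp
    from step[OF this Suc.IH] show ?case by (simp add: mult.assoc)
  qed
  \<comment> \<open>With this \<open>m\<close> the Euclidean contraction factor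
    \<open>C1 * C2 * b ^ m\<close> of \<open>T ^^ m\<close> is below 1.\<close>
  obtain m where "b ^ m < inverse (C1 * C2)"
    using real_arch_pow_inv[of "inverse (C1 * C2)" b] b_less_1 C1(1) C2(1) by auto
  then have m: "C1 * C2 * b ^ m < 1" using C1(1) C2(1) by (simp add: field_simps)
  have "dist ((T ^^ m) u) ((T ^^ m) v) \<le> C1 * C2 * b ^ m * dist u v" for u v
  proof (rule dist_bound)
    fix r
    have "dist (apply_bcontfun ((T ^^ m) u) r) (apply_bcontfun ((T ^^ m) v) r)
        \<le> C1 * N (apply_bcontfun ((T ^^ m) u) r - apply_bcontfun ((T ^^ m) v) r)"
      unfolding dist_norm by (rule C1(2))
    also have "\<dots> \<le> C1 * (b ^ m * (C2 * dist u v))"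
      using iter C1(1) by (intro mult_left_mono) auto
    finally show "dist (apply_bcontfun ((T ^^ m) u) r) (apply_bcontfun ((T ^^ m) v) r)
        \<le> C1 * C2 * b ^ m * dist u v" by (simp add: algebra_simps)
  qed
  then have ex1: "\<exists>!u. (T ^^ m) u = u"
    using m C1(1) C2(1) b_nonneg by (intro banach_fix_type) auto
  then obtain u where u: "(T ^^ m) u = u" by blast
  \<comment> \<open>\<open>T\<close> commutes with its powers, so \<open>T u\<close> is again a
    fixed point of \<open>T ^^ m\<close> and must be \<open>u\<close>.\<close>
  have "(T ^^ m) (T u) = T u" using u by (metis funpow_swap1)
  then have "T u = u" using ex1 u by blast
  then have "apply_bcontfun u r = c + (LINT s:{..r}|lborel. \<Psi> s (apply_bcontfun u s))" for r
    using T[of u r] by argo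
  then have "solves_from_bot \<Psi> c (apply_bcontfun u)"
    unfolding solves_from_bot_def by blast
  then show ?thesis by (rule that)
qed

end

text \<open>The derivative is the pointwise limit of difference quotients with step
  \<open>1 / (n + 1)\<close>, each of which evaluates \<open>F\<close> along continuous curves
  only.\<close>

lemma borel_measurable_directional_derivative:
  fixes F :: "real \<Rightarrow> 'a::euclidean_space \<Rightarrow> 'a"
  assumes meas: "\<And>u. continuous_on UNIV u \<Longrightarrow> (\<lambda>s. F s (u s)) \<in> borel_measurable borel"
    and der: "\<And>s x. (F s has_derivative D s x) (at x)"
    and u: "continuous_on UNIV u" and w: "continuous_on UNIV w"
  shows "(\<lambda>s. D s (u s) (w s)) \<in> borel_measurable borel"
proof (rule borel_measurable_LIMSEQ_metric)
  let ?q = "\<lambda>n s. real (Suc n) *\<^sub>R (F s (u s + inverse (real (Suc n)) *\<^sub>R w s) - F s (u s))"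
  show "?q n \<in> borel_measurable borel" for n
  proof -
    have "(\<lambda>s. F s (u s + inverse (real (Suc n)) *\<^sub>R w s)) \<in> borel_measurable borel"
      by (intro meas continuous_intros u w)
    moreover have "(\<lambda>s. F s (u s)) \<in> borel_measurable borel" by (intro meas u)
    ultimately show ?thesis by simp
  qed
  show "(\<lambda>n. ?q n s) \<longlonglongrightarrow> D s (u s) (w s)" for s
  proof -
    have "((\<lambda>\<theta>. F s (u s + \<theta> *\<^sub>R w s)) has_derivative (\<lambda>\<delta>. D s (u s) (\<delta> *\<^sub>R w s))) (at 0)"
    proof (rule has_derivative_compose[of "\<lambda>\<theta>. u s + \<theta> *\<^sub>R w s" "\<lambda>\<delta>. \<delta> *\<^sub>R w s"])
      show "((\<lambda>\<theta>. u s + \<theta> *\<^sub>R w s) has_derivative (\<lambda>\<delta>. \<delta> *\<^sub>R w s)) (at 0)"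
        by (auto intro!: derivative_eq_intros)
      show "(F s has_derivative D s (u s)) (at (u s + 0 *\<^sub>R w s))" using der by simp
    qed
    moreover have "D s (u s) (\<delta> *\<^sub>R w s) = \<delta> *\<^sub>R D s (u s) (w s)" for \<delta>
      by (rule linear_scale[OF has_derivative_linear[OF der]])
    ultimately have "((\<lambda>\<theta>. F s (u s + \<theta> *\<^sub>R w s)) has_vector_derivative D s (u s) (w s)) (at 0)"
      by (simp add: has_vector_derivative_def)
    then have "((\<lambda>\<theta>. norm (F s (u s + \<theta> *\<^sub>R w s) - F s (u s) - \<theta> *\<^sub>R D s (u s) (w s)) / norm \<theta>) \<longlongrightarrow> 0) (at 0)"
      by (simp add: has_vector_derivative_def has_derivative_at)
    also have "?this \<longleftrightarrow>
        ((\<lambda>\<theta>. norm ((F s (u s + \<theta> *\<^sub>R w s) - F s (u s)) /\<^sub>R \<theta> - D s (u s) (w s))) \<longlongrightarrow> 0) (at 0)"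
    proof (intro tendsto_cong)
      have "norm (z - \<theta> *\<^sub>R v) / norm \<theta> = norm (z /\<^sub>R \<theta> - v)" if "\<theta> \<noteq> 0" for z v :: 'a and \<theta> :: real
      proof -
        have "z /\<^sub>R \<theta> - v = (z - \<theta> *\<^sub>R v) /\<^sub>R \<theta>" using that by (simp add: scaleR_diff_right)
        then show ?thesis by (simp add: divide_inverse mult.commute)
      qed
      then show "\<forall>\<^sub>F \<theta> in at 0. norm (F s (u s + \<theta> *\<^sub>R w s) - F s (u s) - \<theta> *\<^sub>R D s (u s) (w s)) / norm \<theta> =
          norm ((F s (u s + \<theta> *\<^sub>R w s) - F s (u s)) /\<^sub>R \<theta> - D s (u s) (w s))"
        by (simp add: eventually_at_filter)
    qed
    finally have lim: "((\<lambda>\<theta>. (F s (u s + \<theta> *\<^sub>R w s) - F s (u s)) /\<^sub>R \<theta>) \<longlongrightarrow> D s (u s) (w s)) (at 0)"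
      by (rule LIM_zero_cancel[OF tendsto_norm_zero_cancel])
    then show ?thesis
      using filterlim_compose[OF lim, of "\<lambda>n. inverse (real (Suc n))" sequentially] LIMSEQ_inverse_real_of_nat
      by (simp add: filterlim_at)
  qed
qed

section \<open>Differentiability in the value at -\<infinity>\<close>

locale differentiable_contractive_kernel = contractive_kernel N \<beta>
  for N :: "'a::euclidean_space \<Rightarrow> real" and \<beta> :: "real \<Rightarrow> real" +
  fixes F :: "real \<Rightarrow> 'a \<Rightarrow> 'a" and D :: "real \<Rightarrow> 'a \<Rightarrow> 'a \<Rightarrow> 'a"
  assumes F_measurable: "\<And>u. continuous_on UNIV u \<Longrightarrow> (\<lambda>s. F s (u s)) \<in> borel_measurable borel"
    and F_integrable_0: "integrable lborel (\<lambda>s. F s 0)"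
    and F_derivative: "\<And>s x. (F s has_derivative D s x) (at x)"
    and D_continuous: "\<And>s v. continuous_on UNIV (\<lambda>x. D s x v)"
    and D_bound: "AE s in lborel. \<forall>x v. N (D s x v) \<le> \<beta> s * N v"
begin

lemma D_linear: "linear (D s x)"
  by (rule has_derivative_linear[OF F_derivative])

lemma F_admissible: "admissible F"
  unfolding admissible_def
proof (intro conjI allI impI F_measurable F_integrable_0)
  show "AE s in lborel. \<forall>x y. N (F s x - F s y) \<le> \<beta> s * N (x - y)"
    using D_bound
  proof eventually_elim
    case (elim s)
    then show ?case by (intro allI vector_norm_differentiable_bound[OF vn F_derivative]) blast
  qed
qed

definition solution :: "'a \<Rightarrow> real \<Rightarrow> 'a" where
  "solution c = (SOME u. solves_from_bot F c u)"

lemma solution: "solves_from_bot F c (solution c)"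
proof -
  obtain u where "solves_from_bot F c u" by (rule solves_from_bot_exists[OF F_admissible])
  then show ?thesis unfolding solution_def by (rule someI[of "solves_from_bot F c"])
qed

text \<open>The linearised equation has the same kernel as the nonlinear one, so existence,
  uniqueness and both estimates carry over to it.\<close>

lemma D_admissible: "admissible (\<lambda>s. D s (solution c s))"
  unfolding admissible_def
proof (intro conjI allI impI)
  show "(\<lambda>s. D s (solution c s) (w s)) \<in> borel_measurable borel" if "continuous_on UNIV w" for w
    by (rule borel_measurable_directional_derivative[OF F_measurable F_derivative
          solves_from_bot_continuous[OF solution] that])
  show "integrable lborel (\<lambda>s. D s (solution c s) 0)"
    by (simp add: linear_0[OF D_linear])
  show "AE s in lborel. \<forall>x y. N (D s (solution c s) x - D s (solution c s) y) \<le> \<beta> s * N (x - y)"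
    using D_bound by eventually_elim (simp add: linear_diff[OF D_linear, symmetric])
qed

text \<open>The candidate for the derivative of \<open>solution\<close> at \<open>c\<close> in
  direction \<open>v\<close>.\<close>

definition variation :: "'a \<Rightarrow> 'a \<Rightarrow> real \<Rightarrow> 'a" where
  "variation c v = (SOME w. solves_from_bot (\<lambda>s. D s (solution c s)) v w)"

lemma variation: "solves_from_bot (\<lambda>s. D s (solution c s)) v (variation c v)"
proof -
  obtain u where "solves_from_bot (\<lambda>s. D s (solution c s)) v u" by (rule solves_from_bot_exists[OF D_admissible])
  then show ?thesis unfolding variation_def
    by (rule someI[of "solves_from_bot (\<lambda>s. D s (solution c s)) v"])
qed

lemmas solution_continuous = solves_from_bot_continuous[OF solution]
  and solution_bounded = solves_from_bot_bounded[OF solution]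
  and solution_eq = solves_from_bot_eq[OF solution]
  and variation_continuous = solves_from_bot_continuous[OF variation]
  and variation_bounded = solves_from_bot_bounded[OF variation]
  and variation_eq = solves_from_bot_eq[OF variation]

lemma integrable_F_solution: "integrable lborel (\<lambda>s. F s (solution c s))"
  by (rule admissible_integrable[OF F_admissible solution_continuous solution_bounded])

lemma integrable_D_variation: "integrable lborel (\<lambda>s. D s (solution c s) (variation c v s))"
  by (rule admissible_integrable[OF D_admissible variation_continuous variation_bounded])

lemma variation_0: "variation c 0 = (\<lambda>r. 0)"
proof (rule solves_from_bot_unique[OF D_admissible variation])
  show "solves_from_bot (\<lambda>s. D s (solution c s)) 0 (\<lambda>r. 0)"
    by (simp add: solves_from_bot_def linear_0[OF D_linear])
qed

text \<open>Both estimates, in comparison with the zero solution.\<close>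

lemma variation_bound: "N (variation c v r) \<le> N v / (1 - b)"
  and variation_lower_bound: "N v \<le> N (variation c v r) / (1 - b)"
  using solves_from_bot_estimate[OF D_admissible variation[of c v] variation[of c 0], of r]
  by (simp_all add: variation_0)

text \<open>Superposition: sums and multiples of solutions solve the equation with the combined
  data, and uniqueness identifies them.\<close>

lemma variation_linear: "linear (\<lambda>v. variation c v r)"
proof (rule linearI)
  fix v w :: 'a and k :: real
  let ?D = "\<lambda>s. D s (solution c s)"
  have "solves_from_bot ?D (v + w) (\<lambda>r. variation c v r + variation c w r)"
    unfolding solves_from_bot_def
  proof (intro conjI allI)
    fix r
    show "variation c v r + variation c w r = v + w +
        (LINT s:{..r}|lborel. ?D s (variation c v s + variation c w s))"
      by (simp add: variation_eq[of c v r] variation_eq[of c w r] linear_add[OF D_linear]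
          set_integral_add(2)[OF set_integrable_lborel[OF integrable_D_variation]
            set_integrable_lborel[OF integrable_D_variation]])
  qed (intro continuous_intros variation_continuous bounded_plus_comp variation_bounded)+
  from solves_from_bot_unique[OF D_admissible variation this]
  show "variation c (v + w) r = variation c v r + variation c w r" by simp
  have "solves_from_bot ?D (k *\<^sub>R v) (\<lambda>r. k *\<^sub>R variation c v r)"
    unfolding solves_from_bot_def
  proof (intro conjI allI)
    show "bounded (range (\<lambda>r. k *\<^sub>R variation c v r))"
      using bounded_scaling[OF variation_bounded, of k c v] by (simp add: image_image)
    fix r
    show "k *\<^sub>R variation c v r = k *\<^sub>R v + (LINT s:{..r}|lborel. ?D s (k *\<^sub>R variation c v s))"
      by (simp add: variation_eq[of c v r] linear_scale[OF D_linear] scaleR_add_right)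
  qed (intro continuous_intros variation_continuous)
  from solves_from_bot_unique[OF D_admissible variation this]
  show "variation c (k *\<^sub>R v) r = k *\<^sub>R variation c v r" by simp
qed

lemma solution_tendsto:
  assumes "(X \<longlongrightarrow> c) G"
  shows "((\<lambda>n. solution (X n) r) \<longlongrightarrow> solution c r) G"
proof -
  obtain C1 where C1: "C1 > 0" "\<And>x. norm x \<le> C1 * N x" using norm_le_vector_norm[OF vn] by blast
  obtain C2 where C2: "C2 > 0" "\<And>x. N x \<le> C2 * norm x" using vector_norm_le_norm[OF vn] by blast
  have "norm (solution (X n) r - solution c r) \<le> C1 * C2 / (1 - b) * norm (X n - c)" for n
  proof -
    have "norm (solution (X n) r - solution c r) \<le> C1 * N (solution (X n) r - solution c r)"
      by (rule C1(2))
    also have "\<dots> \<le> C1 * (N (X n - c) / (1 - b))"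
      using C1(1) solves_from_bot_estimate(1)[OF F_admissible solution solution]
      by (intro mult_left_mono) auto
    also have "\<dots> \<le> C1 * (C2 * norm (X n - c) / (1 - b))"
      using C1(1) C2(2) b_less_1 by (intro mult_left_mono divide_right_mono) auto
    finally show ?thesis by simp
  qed
  then have "\<forall>\<^sub>F n in G. norm (solution (X n) r - solution c r) \<le> C1 * C2 / (1 - b) * norm (X n - c)"
    by simp
  moreover have "((\<lambda>n. C1 * C2 / (1 - b) * norm (X n - c)) \<longlongrightarrow> 0) G"
    by (intro tendsto_mult_right_zero tendsto_norm_zero LIM_zero assms)
  ultimately have "((\<lambda>n. solution (X n) r - solution c r) \<longlongrightarrow> 0) G"
    by (rule Lim_null_comparison)
  then show ?thesis by (rule LIM_zero_cancel)
qed

text \<open>The difference of the two variations solves the linearised equation at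
  \<open>X n\<close> up to the error of applying two different derivatives to the fixed curve
  \<open>variation c v\<close>. That error tends to 0 in the integral by dominated convergence,
  because \<open>D s\<close> is continuous at each fixed \<open>s\<close>.\<close>

lemma variation_tendsto:
  assumes X: "X \<longlonglongrightarrow> c"
  shows "(\<lambda>n. variation (X n) v r) \<longlonglongrightarrow> variation c v r"
proof -
  let ?w = "variation c v"
  let ?g = "\<lambda>n s. D s (solution (X n) s) (variation (X n) v s) - D s (solution c s) (?w s)"
  let ?k = "\<lambda>n s. N (D s (solution (X n) s) (?w s) - D s (solution c s) (?w s))"
  have intk: "integrable lborel (?k n)" for n
    by (intro integrable_vector_norm[OF vn] Bochner_Integration.integrable_diff
        integrable_D_variation admissible_integrable[OF D_admissible] variation_continuous variation_bounded)
  have "(\<lambda>n. \<integral>s. ?k n s \<partial>lborel) \<longlonglongrightarrow> (\<integral>s. 0 \<partial>(lborel :: real measure))"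
  proof (rule integral_dominated_convergence)
    show "integrable lborel (\<lambda>s. 2 * (N v / (1 - b)) * \<beta> s)" using beta_integrable by simp
    show "AE s in lborel. (\<lambda>n. ?k n s) \<longlonglongrightarrow> 0"
    proof
      fix s
      have "(\<lambda>n. D s (solution (X n) s) (?w s)) \<longlonglongrightarrow> D s (solution c s) (?w s)"
        by (rule continuous_on_tendsto_compose[OF D_continuous solution_tendsto[OF X]]) auto
      then have "(\<lambda>n. D s (solution (X n) s) (?w s) - D s (solution c s) (?w s)) \<longlonglongrightarrow> 0"
        by (rule LIM_zero)
      from continuous_on_tendsto_compose[OF continuous_on_vector_norm[OF vn, of UNIV] this]
      show "(\<lambda>n. ?k n s) \<longlonglongrightarrow> 0" by (simp add: vector_norm_0[OF vn])
    qed
    show "AE s in lborel. norm (?k n s) \<le> 2 * (N v / (1 - b)) * \<beta> s" for n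
      using D_bound
    proof eventually_elim
      case (elim s)
      have "?k n s \<le> N (D s (solution (X n) s) (?w s)) + N (D s (solution c s) (?w s))"
        by (rule vector_norm_diff_triangle[OF vn])
      also have "\<dots> \<le> \<beta> s * N (?w s) + \<beta> s * N (?w s)" using elim by (intro add_mono) auto
      also have "\<dots> = 2 * (\<beta> s * N (?w s))" by simp
      also have "\<dots> \<le> 2 * (\<beta> s * (N v / (1 - b)))"
        by (intro mult_left_mono variation_bound beta_nonneg) simp
      also have "\<dots> = 2 * (N v / (1 - b)) * \<beta> s" by simp
      finally show ?case using vector_norm_nonneg[OF vn] by simp
    qed
  qed (use intk in auto)
  then have lim: "(\<lambda>n. (\<integral>s. ?k n s \<partial>lborel) / (1 - b)) \<longlonglongrightarrow> 0"
    using tendsto_divide_zero by simp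
  have est: "N (variation (X n) v r - ?w r) \<le> (\<integral>s. ?k n s \<partial>lborel) / (1 - b)" for n
  proof -
    have "N (variation (X n) v r - ?w r) \<le> (N 0 + (\<integral>s. ?k n s \<partial>lborel)) / (1 - b)"
    proof (rule forward_estimate[where g = "?g n"])
      show "bounded (range (\<lambda>r. variation (X n) v r - ?w r))"
        using bounded_minus_comp[OF variation_bounded variation_bounded] by blast
      show "integrable lborel (?g n)"
        by (intro Bochner_Integration.integrable_diff integrable_D_variation)
      show "variation (X n) v r - ?w r = 0 + (LINT s:{..r}|lborel. ?g n s)" for r
        by (simp add: variation_eq[of "X n" v r] variation_eq[of c v r]
          set_integral_diff(2)[OF set_integrable_lborel[OF integrable_D_variation]
            set_integrable_lborel[OF integrable_D_variation]])
      show "AE s in lborel. N (?g n s) \<le> \<beta> s * N (variation (X n) v s - ?w s) + ?k n s"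
        using D_bound
      proof eventually_elim
        case (elim s)
        \<comment> \<open>The operator at \<open>X n\<close> is kept on the difference, where the
          kernel bound absorbs it; the change of operator acts on \<open>?w\<close> alone and forms
          the error \<open>?k n\<close>.\<close>
        have "?g n s = D s (solution (X n) s) (variation (X n) v s - ?w s) +
            (D s (solution (X n) s) (?w s) - D s (solution c s) (?w s))"
          by (simp add: linear_diff[OF D_linear])
        then have "N (?g n s) \<le> N (D s (solution (X n) s) (variation (X n) v s - ?w s)) + ?k n s"
          using vector_norm_triangle[OF vn] by metis
        then show ?case using elim by (meson add_right_mono order_trans)
      qed
    qed (use intk vector_norm_nonneg[OF vn] in auto)
    then show ?thesis by (simp add: vector_norm_0[OF vn])
  qed
  obtain C1 where C1: "C1 > 0" "\<And>x. norm x \<le> C1 * N x" using norm_le_vector_norm[OF vn] by blast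
  have "(\<lambda>n. variation (X n) v r - ?w r) \<longlonglongrightarrow> 0"
  proof (rule Lim_null_comparison)
    show "(\<lambda>n. C1 * ((\<integral>s. ?k n s \<partial>lborel) / (1 - b))) \<longlonglongrightarrow> 0"
      using tendsto_mult_left[OF lim, of C1] by simp
    show "\<forall>\<^sub>F n in sequentially. norm (variation (X n) v r - ?w r) \<le> C1 * ((\<integral>s. ?k n s \<partial>lborel) / (1 - b))"
      using C1 est by (intro always_eventually allI order_trans[OF C1(2)] mult_left_mono) auto
  qed
  then show ?thesis by (rule LIM_zero_cancel)
qed

lemma variation_continuous_in_parameter: "continuous_on UNIV (\<lambda>c. variation c v r)"
  unfolding continuous_on_sequentially comp_def using variation_tendsto by blast

text \<open>The deviation from linearity satisfies the forward estimate with the Taylor remainder of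
  \<open>F s\<close> along \<open>solution c\<close> as error. Divided by the length of
  \<open>h\<close>, this remainder tends to 0 for each \<open>s\<close> and is dominated by a
  multiple of \<beta>.\<close>

lemma solution_has_derivative:
  "((\<lambda>c. solution c r) has_derivative (\<lambda>v. variation c v r)) (at c)"
proof -
  let ?\<delta> = "\<lambda>h r. solution (c + h) r - solution c r - variation c h r"
  let ?R = "\<lambda>h s. F s (solution c s + variation c h s) - F s (solution c s) - D s (solution c s) (variation c h s)"
  let ?k = "\<lambda>h s. N (?R h s)"
  have intF: "integrable lborel (\<lambda>s. F s (solution c s + variation c h s))" for h
    by (intro admissible_integrable[OF F_admissible] continuous_intros solution_continuous
        variation_continuous bounded_plus_comp solution_bounded variation_bounded)
  have intk: "integrable lborel (?k h)" for h
    by (intro integrable_vector_norm[OF vn] Bochner_Integration.integrable_diff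
        integrable_D_variation integrable_F_solution intF)
  obtain C1 where C1: "C1 > 0" "\<And>x. norm x \<le> C1 * N x" using norm_le_vector_norm[OF vn] by blast
  obtain C2 where C2: "C2 > 0" "\<And>x. N x \<le> C2 * norm x" using vector_norm_le_norm[OF vn] by blast
  have est: "N (?\<delta> h r) \<le> (\<integral>s. ?k h s \<partial>lborel) / (1 - b)" for h r
  proof -
    let ?g = "\<lambda>s. F s (solution (c + h) s) - F s (solution c s) - D s (solution c s) (variation c h s)"
    have "N (?\<delta> h r) \<le> (N 0 + (\<integral>s. ?k h s \<partial>lborel)) / (1 - b)"
    proof (rule forward_estimate[where g = ?g])
      show "bounded (range (?\<delta> h))"
        using bounded_minus_comp[OF bounded_minus_comp[OF solution_bounded solution_bounded]
          variation_bounded] by blast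
      show "integrable lborel ?g"
        by (intro Bochner_Integration.integrable_diff integrable_D_variation integrable_F_solution)
      show "?\<delta> h r = 0 + (LINT s:{..r}|lborel. ?g s)" for r
        by (simp add: solution_eq[of "c + h" r] solution_eq[of c r] variation_eq[of c h r]
          set_integral_diff[OF set_integrable_lborel set_integrable_lborel]
          set_integrable_lborel integrable_F_solution integrable_D_variation)
      show "AE s in lborel. N (?g s) \<le> \<beta> s * N (?\<delta> h s) + ?k h s"
        using admissible_lipschitz[OF F_admissible]
      proof eventually_elim
        case (elim s)
        \<comment> \<open>Inserting \<open>F\<close> at
          \<open>solution c s + variation c h s\<close> turns the first term into a Lipschitz
          difference in the deviation itself; the second is the Taylor remainder.\<close>
        have "?g s = (F s (solution (c + h) s) - F s (solution c s + variation c h s)) + ?R h s" by simp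
        then have "N (?g s) \<le> N (F s (solution (c + h) s) - F s (solution c s + variation c h s)) + ?k h s"
          using vector_norm_triangle[OF vn] by metis
        moreover have "N (F s (solution (c + h) s) - F s (solution c s + variation c h s)) \<le> \<beta> s * N (?\<delta> h s)"
          using elim[rule_format, of "solution (c + h) s" "solution c s + variation c h s"]
          by (simp add: diff_diff_eq)
        ultimately show ?case by linarith
      qed
    qed (use intk vector_norm_nonneg[OF vn] in auto)
    then show ?thesis by (simp add: vector_norm_0[OF vn])
  qed
  have lim: "(\<lambda>n. (\<integral>s. ?k (X n) s / norm (X n) \<partial>lborel)) \<longlonglongrightarrow> 0"
    if X: "X \<longlonglongrightarrow> 0" "\<And>n. X n \<noteq> 0" for X
  proof -
    have "(\<lambda>n. (\<integral>s. ?k (X n) s / norm (X n) \<partial>lborel)) \<longlonglongrightarrow> (\<integral>s. 0 \<partial>(lborel :: real measure))"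
    proof (rule integral_dominated_convergence)
      show "integrable lborel (\<lambda>s. 2 * (C2 / (1 - b)) * \<beta> s)" using beta_integrable by simp
      show "AE s in lborel. norm (?k (X n) s / norm (X n)) \<le> 2 * (C2 / (1 - b)) * \<beta> s" for n
        using D_bound admissible_lipschitz[OF F_admissible]
      proof eventually_elim
        case (elim s)
        let ?w = "variation c (X n) s"
        have "?k (X n) s \<le> N (F s (solution c s + ?w) - F s (solution c s)) + N (D s (solution c s) ?w)"
          by (rule vector_norm_diff_triangle[OF vn])
        also have "\<dots> \<le> \<beta> s * N ?w + \<beta> s * N ?w"
          using elim(1) elim(2)[rule_format, of "solution c s + ?w" "solution c s"] by (intro add_mono) auto
        also have "\<dots> = 2 * (\<beta> s * N ?w)" by simp
        also have "\<beta> s * N ?w \<le> \<beta> s * (N (X n) / (1 - b))"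
          by (intro mult_left_mono variation_bound beta_nonneg)
        also have "\<beta> s * (N (X n) / (1 - b)) \<le> \<beta> s * (C2 * norm (X n) / (1 - b))"
          using b_less_1 C2(2) by (intro mult_left_mono divide_right_mono beta_nonneg) auto
        finally have "?k (X n) s \<le> 2 * (C2 / (1 - b)) * \<beta> s * norm (X n)" by (simp add: algebra_simps)
        then show ?case using X(2)[of n] vector_norm_nonneg[OF vn] by (simp add: pos_divide_le_eq)
      qed
      show "AE s in lborel. (\<lambda>n. ?k (X n) s / norm (X n)) \<longlonglongrightarrow> 0"
      proof
        fix s
        \<comment> \<open>At fixed \<open>s\<close> the variation is linear in \<open>h\<close>, so
          the chain rule at \<open>h = 0\<close> measures the remainder against \<open>h\<close>
          directly. This avoids dividing by the variation.\<close>
        have "((\<lambda>h. variation c h s) has_derivative (\<lambda>h. variation c h s)) (at 0)"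
          by (rule linear_imp_has_derivative[OF variation_linear])
        then have "((\<lambda>h. solution c s + variation c h s) has_derivative (\<lambda>h. variation c h s)) (at 0)"
          using has_derivative_add[OF has_derivative_const] by fastforce
        from has_derivative_compose[OF this F_derivative]
        have "((\<lambda>h. F s (solution c s + variation c h s)) has_derivative
            (\<lambda>h. D s (solution c s) (variation c h s))) (at 0)"
          by (simp add: variation_0)
        then have "((\<lambda>h. norm (?R h s) / norm h) \<longlongrightarrow> 0) (at 0)"
          by (simp add: has_derivative_at variation_0)
        then have "(\<lambda>n. norm (?R (X n) s) / norm (X n)) \<longlonglongrightarrow> 0"
          by (rule filterlim_compose) (use X in \<open>auto simp: filterlim_at\<close>)
        then have "(\<lambda>n. C2 * (norm (?R (X n) s) / norm (X n))) \<longlonglongrightarrow> 0"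
          by (rule tendsto_mult_right_zero)
        then show "(\<lambda>n. ?k (X n) s / norm (X n)) \<longlonglongrightarrow> 0"
        proof (rule Lim_null_comparison[rotated])
          show "\<forall>\<^sub>F n in sequentially. norm (?k (X n) s / norm (X n)) \<le> C2 * (norm (?R (X n) s) / norm (X n))"
            using C2(2) vector_norm_nonneg[OF vn] by (auto intro!: always_eventually divide_right_mono)
        qed
      qed
      show "(\<lambda>s. ?k (X n) s / norm (X n)) \<in> borel_measurable lborel" for n
        using borel_measurable_integrable[OF intk[of "X n"]] by simp
    qed simp
    then show ?thesis by simp
  qed
  show ?thesis
    unfolding has_derivative_at
  proof (rule conjI)
    show "bounded_linear (\<lambda>v. variation c v r)"
      using variation_linear by (simp add: linear_conv_bounded_linear)
    show "((\<lambda>h. norm (?\<delta> h r) / norm h) \<longlongrightarrow> 0) (at 0)"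
      unfolding tendsto_at_iff_sequentially comp_def
    proof (intro allI impI)
      fix X :: "nat \<Rightarrow> 'a" assume X: "\<forall>i. X i \<in> UNIV - {0}" "X \<longlonglongrightarrow> 0"
      have "(\<lambda>n. \<integral>s. ?k (X n) s / norm (X n) \<partial>lborel) \<longlonglongrightarrow> 0"
        by (rule lim[OF X(2)]) (use X(1) in auto)
      then have "(\<lambda>n. C1 / (1 - b) * (\<integral>s. ?k (X n) s / norm (X n) \<partial>lborel)) \<longlonglongrightarrow> 0"
        by (rule tendsto_mult_right_zero)
      then show "(\<lambda>n. norm (?\<delta> (X n) r) / norm (X n)) \<longlonglongrightarrow> 0"
      proof (rule Lim_null_comparison[rotated])
        have "norm (?\<delta> h r) \<le> C1 / (1 - b) * (\<integral>s. ?k h s \<partial>lborel)" for h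
          using order_trans[OF C1(2) mult_left_mono[OF est]] C1(1) by simp
        from divide_right_mono[OF this norm_ge_zero]
        have "norm (?\<delta> h r) / norm h \<le> C1 / (1 - b) * (\<integral>s. ?k h s / norm h \<partial>lborel)" for h
          by simp
        then show "\<forall>\<^sub>F n in sequentially. norm (norm (?\<delta> (X n) r) / norm (X n))
            \<le> C1 / (1 - b) * (\<integral>s. ?k (X n) s / norm (X n) \<partial>lborel)"
          by (intro always_eventually allI) (simp only: real_norm_def abs_divide abs_norm_cancel)
      qed
    qed
  qed
qed

end

section \<open>Matrices and diffeomorphisms\<close>

lemma tendsto_det:
  fixes L :: "real ^ 'n ^ 'n"
  assumes "\<And>i j. ((\<lambda>x. B x $ i $ j) \<longlongrightarrow> L $ i $ j) G"
  shows "((\<lambda>x. det (B x)) \<longlongrightarrow> det L) G"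
  unfolding det_def by (intro tendsto_intros assms)

lemma continuous_on_det:
  fixes B :: "'a::topological_space \<Rightarrow> real ^ 'n ^ 'n"
  assumes "\<And>i j. continuous_on S (\<lambda>x. B x $ i $ j)"
  shows "continuous_on S (\<lambda>x. det (B x))"
  using assms unfolding continuous_on_def by (auto intro!: tendsto_det)

lemma matrix_inv_cancel:
  fixes B :: "real ^ 'n ^ 'n"
  assumes "invertible B"
  shows "B ** matrix_inv B = mat 1" and "matrix_inv B ** B = mat 1"
  using assms unfolding invertible_def matrix_inv_def by (metis (mono_tags, lifting) someI_ex)+

lemma matrix_inv_vector_cancel:
  fixes B :: "real ^ 'n ^ 'n"
  assumes "invertible B"
  shows "B *v (matrix_inv B *v x) = x" and "matrix_inv B *v (B *v x) = x"
  by (simp_all add: matrix_vector_mul_assoc matrix_inv_cancel[OF assms])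

lemma matrix_vector_mult_axis_nth: "(B *v axis j (1::real)) $ i = B $ i $ j"
  by (simp add: matrix_vector_mult_basis column_def)

text \<open>Continuity is read off Cramer's rule.\<close>

lemma continuous_on_matrix_inv:
  fixes B :: "'a::topological_space \<Rightarrow> real ^ 'n ^ 'n"
  assumes "continuous_on S B" "\<And>x. x \<in> S \<Longrightarrow> invertible (B x)"
  shows "continuous_on S (\<lambda>x. matrix_inv (B x))"
proof -
  let ?C = "\<lambda>x i j. (\<chi> k l. if l = i then axis j 1 $ k else B x $ k $ l) :: real ^ 'n ^ 'n"
  have cont: "continuous_on S (\<lambda>x. B x $ i $ j)" for i j
    by (intro continuous_on_component assms)
  have det: "det (B x) \<noteq> 0" if "x \<in> S" for x
    using assms(2)[OF that] by (simp add: invertible_det_nz)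
  have eq: "matrix_inv (B x) $ i $ j = det (?C x i j) / det (B x)" if "x \<in> S" for x i j
  proof -
    have "B x *v (matrix_inv (B x) *v axis j 1) = axis j 1"
      by (rule matrix_inv_vector_cancel[OF assms(2)[OF that]])
    then have "matrix_inv (B x) *v axis j 1 = (\<chi> i. det (?C x i j) / det (B x))"
      by (simp only: cramer[OF det[OF that]])
    then have "(matrix_inv (B x) *v axis j 1) $ i = det (?C x i j) / det (B x)" by simp
    then show ?thesis by (simp only: matrix_vector_mult_axis_nth)
  qed
  have "continuous_on S (\<lambda>x. matrix_inv (B x) $ i $ j)" for i j
  proof (subst continuous_on_cong[OF refl eq])
    have "continuous_on S (\<lambda>x. ?C x i j $ k $ l)" for k l
      using cont by (cases "l = i") simp_all
    then show "continuous_on S (\<lambda>x. det (?C x i j) / det (B x))"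
      by (intro continuous_on_divide continuous_on_det cont) (use det in auto)
  qed
  then have "continuous_on S (\<lambda>x. \<chi> i j. matrix_inv (B x) $ i $ j)"
    by (intro continuous_on_vec_lambda)
  then show ?thesis by simp
qed

lemma bounded_bilinear_matrix_vector_mult:
  "bounded_bilinear ((*v) :: real ^ 'n ^ 'm \<Rightarrow> real ^ 'n \<Rightarrow> real ^ 'm)"
proof -
  have "bilinear ((*v) :: real ^ 'n ^ 'm \<Rightarrow> real ^ 'n \<Rightarrow> real ^ 'm)"
    unfolding bilinear_def
    by (auto intro!: linearI simp: matrix_vector_mult_add_rdistrib matrix_vector_right_distrib
        scaleR_matrix_vector_assoc matrix_vector_mult_scaleR)
  then show ?thesis by (simp add: bilinear_conv_bounded_bilinear)
qed

lemmas continuous_on_matrix_vector_mult =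
  bounded_bilinear.continuous_on[OF bounded_bilinear_matrix_vector_mult]

text \<open>In finite dimension, continuity of the derivative in operator norm follows from
  continuity in each fixed direction.\<close>

lemma C1_mapI:
  fixes g :: "'a::euclidean_space \<Rightarrow> 'b::real_normed_vector"
  assumes der: "\<And>x. (g has_derivative g' x) (at x)"
    and cont: "\<And>v. continuous_on UNIV (\<lambda>x. g' x v)"
  shows "C1_map g"
  unfolding C1_map_def
proof (intro exI[of _ "\<lambda>x. Blinfun (g' x)"] conjI allI)
  have "bounded_linear (g' x)" for x using der by (rule has_derivative_bounded_linear)
  then have [simp]: "blinfun_apply (Blinfun (g' x)) = g' x" for x by (rule bounded_linear_Blinfun_apply)
  show "(g has_derivative blinfun_apply (Blinfun (g' x))) (at x)" for x using der by simp
  show "continuous_on UNIV (\<lambda>x. Blinfun (g' x))"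
    by (rule continuous_on_blinfun_componentwise) (simp add: cont)
qed

text \<open>A continuous inverse of a map with invertible derivative is differentiable, with the
  inverse matrix as its Jacobian. Continuity of matrix inversion makes the derivative continuous,
  and the determinant is the reciprocal of a positive one.\<close>

lemma orientation_preserving_diffeomorphism_inverse:
  fixes H G :: "real ^ 'n \<Rightarrow> real ^ 'n"
  assumes GH: "\<And>c. G (H c) = c" and HG: "\<And>x. H (G x) = x"
    and der: "\<And>c. (H has_derivative H' c) (at c)"
    and cont: "\<And>v. continuous_on UNIV (\<lambda>c. H' c v)"
    and det: "\<And>c. det (matrix (H' c)) > 0"
    and contG: "continuous_on UNIV G"
  shows "orientation_preserving_diffeomorphism G"
proof -
  let ?B = "\<lambda>c. matrix (H' c)"
  have inv: "invertible (?B c)" for c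
    using det[of c] by (simp add: invertible_det_nz)
  have H': "H' c v = ?B c *v v" for c v
    using matrix_works[of "H' c" v] has_derivative_linear[OF der[of c]] by simp
  have contB: "continuous_on UNIV ?B"
    unfolding matrix_def by (intro continuous_on_vec_lambda continuous_on_component cont)
  have derG: "(G has_derivative (\<lambda>v. matrix_inv (?B (G x)) *v v)) (at x)" for x
  proof (rule has_derivative_inverse_basic[OF der _ _ _ open_UNIV UNIV_I])
    show "bounded_linear (\<lambda>v. matrix_inv (?B (G x)) *v v)" by (rule matrix_vector_mul_bounded_linear)
    show "(\<lambda>v. matrix_inv (?B (G x)) *v v) \<circ> H' (G x) = id"
      by (rule ext) (simp add: H' matrix_inv_vector_cancel[OF inv])
    show "continuous (at x) G" using contG by (simp add: continuous_on_eq_continuous_at)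
  qed (rule HG)
  have "C1_map G"
  proof (rule C1_mapI[OF derG])
    have "continuous_on UNIV (\<lambda>x. matrix_inv (?B (G x)))"
      by (intro continuous_on_matrix_inv continuous_on_compose2[OF contB contG] inv) simp
    then show "continuous_on UNIV (\<lambda>x. matrix_inv (?B (G x)) *v v)" for v
      by (intro continuous_on_matrix_vector_mult continuous_on_const)
  qed
  moreover have "C1_map H" by (rule C1_mapI[OF der cont])
  moreover have "bij G" using GH HG by (metis bij_iff)
  moreover have "inv G = H" using GH HG by (intro inv_equality) auto
  moreover have "det (jacobian G (at x)) > 0" for x
  proof -
    have "jacobian G (at x) = matrix_inv (?B (G x))"
      unfolding jacobian_def using frechet_derivative_at[OF derG] matrix_of_matrix_vector_mul
      by metis
    moreover have "det (matrix_inv (?B (G x))) * det (?B (G x)) = 1"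
      using det_mul[of "matrix_inv (?B (G x))" "?B (G x)"] by (simp add: matrix_inv_cancel[OF inv])
    ultimately show ?thesis using det[of "G x"] by (metis zero_less_mult_pos2 zero_less_one)
  qed
  ultimately show ?thesis
    by (simp add: orientation_preserving_diffeomorphism_def C1_diffeomorphism_def)
qed

section \<open>Orientation: the sign of the determinant of the variation\<close>

locale contractive_matrix_kernel = differentiable_contractive_kernel N \<beta> F D
  for N :: "real ^ 'n \<Rightarrow> real" and \<beta> :: "real \<Rightarrow> real"
    and F :: "real \<Rightarrow> real ^ 'n \<Rightarrow> real ^ 'n" and D :: "real \<Rightarrow> real ^ 'n \<Rightarrow> real ^ 'n \<Rightarrow> real ^ 'n"
begin

text \<open>The backward bound recovers \<open>v\<close> from its variation at any time
  \<open>r\<close>, so the linear map is injective.\<close>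

lemma det_variation_nonzero: "det (matrix (\<lambda>v. variation c v r)) \<noteq> 0"
proof -
  have "inj (\<lambda>v. variation c v r)"
    unfolding linear_injective_0[OF variation_linear]
  proof (intro allI impI)
    fix v assume "variation c v r = 0"
    then have "N v \<le> 0" using variation_lower_bound[of v c r] by (simp add: vector_norm_0[OF vn])
    then show "v = 0" using vector_norm_nonneg[OF vn, of v] vector_norm_zero[OF vn, of v] by linarith
  qed
  then show ?thesis using det_nz_iff_inj[OF variation_linear] by blast
qed

text \<open>The determinant does not vanish along the whole line and tends to \<open>1\<close> at \<open>-\<infinity>\<close>.\<close>

lemma det_variation_pos: "det (matrix (\<lambda>v. variation c v r)) > 0"
proof (rule ccontr)
  let ?d = "\<lambda>r. det (matrix (\<lambda>v. variation c v r))"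
  assume neg: "\<not> ?thesis"
  have "(\<lambda>n. ?d (- real n)) \<longlonglongrightarrow> det (mat 1 :: real ^ 'n ^ 'n)"
  proof (rule tendsto_det)
    fix i j :: 'n
    \<comment> \<open>The \<open>j\<close>-th column is the variation of the \<open>j\<close>-th
      basis vector, which tends to that vector at -\<infinity>.\<close>
    have "(\<lambda>n. variation c (axis j 1) (- real n)) \<longlonglongrightarrow> axis j 1 + 0"
      unfolding variation_eq[of c "axis j 1" "- real n" for n]
      by (intro tendsto_add tendsto_const tendsto_LINT_atMost_at_bot integrable_D_variation)
    from tendsto_vec_nth[OF this, of i]
    show "(\<lambda>n. matrix (\<lambda>v. variation c v (- real n)) $ i $ j) \<longlonglongrightarrow> mat 1 $ i $ j"
      by (simp add: matrix_def mat_def axis_def)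
  qed
  then have "\<forall>\<^sub>F n in sequentially. ?d (- real n) > 0"
    by (intro order_tendstoD(1)[where a = 0]) (auto simp: det_I)
  then obtain n where n: "?d (- real n) > 0"
    by (auto simp: eventually_sequentially)
  have "continuous_on UNIV ?d"
    by (intro continuous_on_det) (simp add: matrix_def continuous_on_component variation_continuous)
  then have "connected (range ?d)" by (rule connected_continuous_image) (rule connected_UNIV)
  moreover have "?d r \<in> range ?d" "?d (- real n) \<in> range ?d" by blast+
  moreover have "?d r \<le> 0" using neg by linarith
  ultimately have "0 \<in> range ?d" using less_imp_le[OF n] by (rule connectedD_interval)
  then obtain s where "0 = ?d s" by (rule imageE)
  then show False using det_variation_nonzero[of c s] by linarith
qed

text \<open>The inverse function argument is applied to \<open>\<lambda>c. solution c t\<close>.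
  Continuity of \<open>G\<close> comes from the second half of
  \<open>solves_from_bot_estimate\<close>, which makes it Lipschitz.\<close>

lemma inverse_of_solution_orientation_preserving:
  assumes GH: "\<And>c. G (solution c t) = c" and HG: "\<And>x. solution (G x) t = x"
  shows "orientation_preserving_diffeomorphism G"
proof (rule orientation_preserving_diffeomorphism_inverse[OF GH HG solution_has_derivative
      variation_continuous_in_parameter det_variation_pos])
  obtain C1 where C1: "C1 > 0" "\<And>x. norm x \<le> C1 * N x" using norm_le_vector_norm[OF vn] by blast
  obtain C2 where C2: "C2 > 0" "\<And>x. N x \<le> C2 * norm x" using vector_norm_le_norm[OF vn] by blast
  have "dist (G x) (G x') \<le> C1 * C2 / (1 - b) * dist x x'" for x x'
  proof -
    have "norm (G x - G x') \<le> C1 * N (G x - G x')" by (rule C1(2))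
    also have "\<dots> \<le> C1 * (N (x - x') / (1 - b))"
      using solves_from_bot_estimate(2)[OF F_admissible solution[of "G x"] solution[of "G x'"], of t] C1(1)
      by (intro mult_left_mono) (simp_all add: HG)
    also have "\<dots> \<le> C1 * (C2 * norm (x - x') / (1 - b))"
      using C1(1) C2(2) b_less_1 by (intro mult_left_mono divide_right_mono) auto
    finally show ?thesis by (simp add: dist_norm)
  qed
  then have "(C1 * C2 / (1 - b))-lipschitz_on UNIV G"
    using C1(1) C2(1) b_less_1 by (intro lipschitz_onI) auto
  then show "continuous_on UNIV G" by (rule lipschitz_on_continuous_on)
qed

end

text \<open>A pointwise bound need not be measurable; its restriction to a countable dense set of
  points and directions is.\<close>

lemma countable_kernel_bound:
  fixes N :: "'a::euclidean_space \<Rightarrow> real" and D :: "real \<Rightarrow> 'a \<Rightarrow> 'a \<Rightarrow> 'a"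
  assumes vn: "vector_norm N"
    and meas: "\<And>x v. (\<lambda>s. D s x v) \<in> borel_measurable borel"
    and cont: "\<And>s v. continuous_on UNIV (\<lambda>x. D s x v)"
    and lin: "\<And>s x. linear (D s x)"
    and le: "\<And>s x v. ennreal (N (D s x v) / N v) \<le> h s"
    and h: "(\<integral>\<^sup>+ s. h s \<partial>lborel) < 1"
  obtains \<beta> where "integrable lborel \<beta>" "\<And>s. 0 \<le> \<beta> s" "(\<integral>s. \<beta> s \<partial>lborel) < 1"
    "AE s in lborel. \<forall>x v. N (D s x v) \<le> \<beta> s * N v"
proof -
  obtain Q :: "'a set" where Q: "countable Q" "\<And>U. open U \<Longrightarrow> U \<noteq> {} \<Longrightarrow> \<exists>q\<in>Q. q \<in> U"
    using countable_dense_exists by blast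
  \<comment> \<open>A closed condition that holds on the dense set \<open>Q\<close> holds
    everywhere; it is used first for the base point and then for the direction.\<close>
  have all: "P x" if "closed {x. P x}" "\<And>q. q \<in> Q \<Longrightarrow> P q" for P x
  proof (rule ccontr)
    assume "\<not> P x"
    then have "\<exists>q\<in>Q. q \<in> - {x. P x}" using that(1) by (intro Q(2)) (auto simp: open_Compl)
    then show False using that(2) by auto
  qed
  define \<kappa> where "\<kappa> = (\<lambda>s. SUP (x, v)\<in>Q \<times> Q. ennreal (N (D s x v) / N v))"
  have [measurable]: "\<kappa> \<in> borel_measurable lborel"
    unfolding \<kappa>_def
  proof (intro borel_measurable_SUP)
    show "countable (Q \<times> Q)" using Q(1) by simp
    show "(\<lambda>s. case p of (x, v) \<Rightarrow> ennreal (N (D s x v) / N v)) \<in> borel_measurable lborel" for p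
      using borel_measurable_vector_norm[OF vn meas, of "fst p" "snd p"] by (simp add: split_beta)
  qed
  \<comment> \<open>\<open>nn_integral\<close> is monotone even for a non-measurable
    \<open>h\<close>, being a supremum over simple functions below the integrand.\<close>
  have \<kappa>: "(\<integral>\<^sup>+ s. \<kappa> s \<partial>lborel) < 1"
  proof (rule le_less_trans[OF nn_integral_mono h])
    show "\<kappa> s \<le> h s" for s unfolding \<kappa>_def using le by (auto intro!: SUP_least)
  qed
  define \<beta> where "\<beta> = (\<lambda>s. enn2real (\<kappa> s))"
  have nn: "(\<integral>\<^sup>+ s. ennreal (\<beta> s) \<partial>lborel) < 1"
  proof (rule le_less_trans[OF nn_integral_mono \<kappa>])
    \<comment> \<open>\<open>enn2real\<close> sends infinity to 0, so this is an inequality in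
      general and an equality wherever \<kappa> is finite.\<close>
    show "ennreal (\<beta> s) \<le> \<kappa> s" for s by (cases "\<kappa> s") (auto simp: \<beta>_def)
  qed
  have int: "integrable lborel \<beta>"
    using nn by (intro integrableI_nonneg) (auto simp: \<beta>_def intro: less_trans)
  have "ennreal (\<integral>s. \<beta> s \<partial>lborel) < 1"
    using nn nn_integral_eq_integral[OF int] by (simp add: \<beta>_def)
  then have lt1: "(\<integral>s. \<beta> s \<partial>lborel) < 1" by simp
  have "AE s in lborel. \<kappa> s \<noteq> \<infinity>"
    using \<kappa> by (intro nn_integral_PInf_AE) auto
  then have "AE s in lborel. \<forall>x v. N (D s x v) \<le> \<beta> s * N v"
  proof eventually_elim
    case (elim s)
    have QQ: "N (D s x v) \<le> \<beta> s * N v" if "x \<in> Q" "v \<in> Q" for x v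
    proof (cases "v = 0")
      case False
      then have Nv: "N v > 0" using vector_norm_nonneg[OF vn, of v] vector_norm_zero[OF vn, of v] by linarith
      have "ennreal (N (D s x v) / N v) \<le> \<kappa> s"
        unfolding \<kappa>_def using that by (intro SUP_upper2[of "(x, v)"]) auto
      also have "\<kappa> s = ennreal (\<beta> s)" using elim by (simp add: \<beta>_def less_top)
      finally have "N (D s x v) / N v \<le> \<beta> s" by (simp add: \<beta>_def)
      then show ?thesis using Nv by (simp add: field_simps)
    qed (simp add: linear_0[OF lin] vector_norm_0[OF vn])
    have xQ: "N (D s x v) \<le> \<beta> s * N v" if "v \<in> Q" for x v
    proof (rule all[of "\<lambda>x. N (D s x v) \<le> \<beta> s * N v"])
      show "closed {x. N (D s x v) \<le> \<beta> s * N v}"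
        by (intro closed_Collect_le continuous_on_compose2[OF continuous_on_vector_norm[OF vn] cont]
            continuous_on_const) auto
    qed (use QQ that in auto)
    show ?case
    proof (intro allI)
      fix x v
      show "N (D s x v) \<le> \<beta> s * N v"
      proof (rule all[of "\<lambda>v. N (D s x v) \<le> \<beta> s * N v"])
        have "continuous_on UNIV (D s x)" by (rule linear_continuous_on[OF linear_conv_bounded_linear[THEN iffD1, OF lin]])
        then show "closed {v. N (D s x v) \<le> \<beta> s * N v}"
          by (intro closed_Collect_le continuous_on_compose2[OF continuous_on_vector_norm[OF vn]]
              continuous_on_mult continuous_on_const continuous_on_vector_norm[OF vn]) auto
      qed (use xQ in auto)
    qed
  qed
  with int lt1 show ?thesis by (intro that[of \<beta>]) (auto simp: \<beta>_def)
qed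

section \<open>Differential equations\<close>

text \<open>\<open>exp (\<plusminus> 2 * L * s) * (w s \<bullet> w s)\<close> is monotone.\<close>

lemma vanishing_if_derivative_bounded_by_self:
  fixes w :: "real \<Rightarrow> 'a::real_inner"
  assumes cont: "continuous_on {a..b} w"
    and der: "\<And>s. a < s \<Longrightarrow> s < b \<Longrightarrow> (w has_vector_derivative w' s) (at s)"
    and le: "\<And>s. a < s \<Longrightarrow> s < b \<Longrightarrow> norm (w' s) \<le> L * norm (w s)"
    and zero: "w a = 0 \<or> w b = 0" and s: "a \<le> s" "s \<le> b"
  shows "w s = 0"
proof -
  let ?E = "\<lambda>k s. exp (k * s) * (w s \<bullet> w s)"
  have E': "(?E k has_real_derivative exp (k * s) * (k * (w s \<bullet> w s) + 2 * (w s \<bullet> w' s))) (at s)"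
    if "a < s" "s < b" for k s
  proof -
    have "((\<lambda>s. w s \<bullet> w s) has_vector_derivative w s \<bullet> w' s + w' s \<bullet> w s) (at s)"
      by (rule bounded_bilinear.has_vector_derivative[OF bounded_bilinear_inner der der]) (use that in auto)
    then have "((\<lambda>s. w s \<bullet> w s) has_real_derivative 2 * (w s \<bullet> w' s)) (at s)"
      by (simp add: has_real_derivative_iff_has_vector_derivative inner_commute)
    then show ?thesis by (auto intro!: derivative_eq_intros simp: algebra_simps)
  qed
  have contE: "continuous_on {c..d} (?E k)" if "a \<le> c" "d \<le> b" for c d k
    using that by (intro continuous_intros continuous_on_subset[OF cont]) auto
  have bound: "\<bar>w s \<bullet> w' s\<bar> \<le> L * (w s \<bullet> w s)" if "a < s" "s < b" for s
  proof -
    have "\<bar>w s \<bullet> w' s\<bar> \<le> norm (w s) * norm (w' s)" by (rule Cauchy_Schwarz_ineq2)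
    also have "\<dots> \<le> norm (w s) * (L * norm (w s))" by (intro mult_left_mono le that) simp
    finally show ?thesis by (simp add: dot_square_norm power2_eq_square algebra_simps)
  qed
  \<comment> \<open>The increasing weight propagates a zero at \<open>b\<close> backwards; the
    decreasing one below propagates a zero at \<open>a\<close> forwards.\<close>
  have "?E (2 * L) s \<le> ?E (2 * L) b"
  proof (rule DERIV_nonneg_imp_increasing_open[OF s(2)])
    fix x assume "s < x" "x < b"
    then have x: "a < x" "x < b" using s by auto
    show "\<exists>y. (?E (2 * L) has_real_derivative y) (at x) \<and> 0 \<le> y"
      by (rule exI, rule conjI[OF E'[OF x]]) (use bound[OF x] in \<open>auto intro!: mult_nonneg_nonneg\<close>)
  qed (rule contE; use s in simp)
  moreover have "?E (- 2 * L) s \<le> ?E (- 2 * L) a"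
  proof (rule DERIV_nonpos_imp_decreasing_open[OF s(1)])
    fix x assume "a < x" "x < s"
    then have x: "a < x" "x < b" using s by auto
    show "\<exists>y. (?E (- 2 * L) has_real_derivative y) (at x) \<and> y \<le> 0"
      by (rule exI, rule conjI[OF E'[OF x]]) (use bound[OF x] in \<open>auto intro!: mult_nonneg_nonpos\<close>)
  qed (rule contE; use s in simp)
  ultimately have "w s \<bullet> w s \<le> 0" using zero by (auto simp: mult_le_0_iff)
  then have "w s \<bullet> w s = 0" using inner_ge_zero by (rule antisym)
  then show ?thesis by (rule inner_eq_zero_iff[THEN iffD1])
qed

text \<open>Below \<open>a\<close> the integral contributes a constant; on \<open>{a..b}\<close>,
  where \<open>g\<close> is continuous, the fundamental theorem applies. Only local continuity is
  asked, since the integrands will be cut off at a final time.\<close>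

lemma LINT_atMost_has_vector_derivative:
  fixes g :: "real \<Rightarrow> 'a::euclidean_space"
  assumes int: "integrable lborel g" and cont: "continuous_on {a..b} g" and r: "a < r" "r < b"
  shows "((\<lambda>r. LINT s:{..r}|lborel. g s) has_vector_derivative g r) (at r)"
proof -
  have eq: "(LINT s:{..x}|lborel. g s) = (LINT s:{..<a}|lborel. g s) + integral {a..x} g"
    if "x \<in> {a<..<b}" for x
  proof -
    have "(LINT s:{..<a} \<union> {a..x}|lborel. g s) =
        (LINT s:{..<a}|lborel. g s) + (LINT s:{a..x}|lborel. g s)"
      by (intro set_integral_Un set_integrable_lborel[OF int]) auto
    moreover have "{..<a} \<union> {a..x} = {..x}" using that by auto
    moreover have "(LINT s:{a..x}|lborel. g s) = integral {a..x} g"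
      by (intro set_borel_integral_eq_integral(2) set_integrable_lborel[OF int]) simp
    ultimately show ?thesis by simp
  qed
  have "((\<lambda>x. integral {a..x} g) has_vector_derivative g r) (at r within {a..b})"
    using r by (intro integral_has_vector_derivative cont) auto
  then have "((\<lambda>x. integral {a..x} g) has_vector_derivative g r) (at r)"
    using r at_within_interior[of r "{a..b}"] by simp
  then have "((\<lambda>x. (LINT s:{..<a}|lborel. g s) + integral {a..x} g) has_vector_derivative g r) (at r)"
    using has_vector_derivative_add[OF has_vector_derivative_const] by fastforce
  then show ?thesis
  proof (rule has_vector_derivative_transform_within_open)
    show "open {a<..<b}" "r \<in> {a<..<b}" using r by auto
  qed (use eq in auto)
qed

lemma integrable_exp_decay:
  fixes \<alpha> t :: real
  assumes "\<alpha> > 0"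
  shows "integrable lborel (\<lambda>s. indicator {..t} s * exp (- \<alpha> * (t - s)))"
proof -
  have "set_integrable lborel (einterval (- \<infinity>) (ereal t)) (\<lambda>s. exp (- \<alpha> * (t - s)))"
  proof (rule interval_integral_FTC_nonneg(1)[where F = "\<lambda>s. exp (- \<alpha> * (t - s)) / \<alpha>" and A = 0 and B = "1 / \<alpha>"])
    show "DERIV (\<lambda>s. exp (- \<alpha> * (t - s)) / \<alpha>) x :> exp (- \<alpha> * (t - x))" for x
      using assms by (auto intro!: derivative_eq_intros)
    show "isCont (\<lambda>s. exp (- \<alpha> * (t - s))) x" for x by (intro continuous_intros)
    have "((\<lambda>s. exp (- \<alpha> * (t - s)) / \<alpha>) \<longlongrightarrow> 0) at_bot"
    proof -
      have "filterlim (\<lambda>s. - \<alpha> * (t - s)) at_bot at_bot"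
        unfolding filterlim_at_bot
      proof
        fix Z
        have "\<forall>s\<le>t + Z / \<alpha>. - \<alpha> * (t - s) \<le> Z" using assms by (auto simp: field_simps)
        then show "\<forall>\<^sub>F s in at_bot. - \<alpha> * (t - s) \<le> Z" unfolding eventually_at_bot_linorder by blast
      qed
      from filterlim_compose[OF exp_at_bot this] show ?thesis by (rule tendsto_divide_zero)
    qed
    then show "(((\<lambda>s. exp (- \<alpha> * (t - s)) / \<alpha>) \<circ> real_of_ereal) \<longlongrightarrow> 0) (at_right (- \<infinity>))"
      by (simp add: ereal_tendsto_simps)
    have "((\<lambda>s. exp (- \<alpha> * (t - s)) / \<alpha>) \<longlongrightarrow> exp (- \<alpha> * (t - t)) / \<alpha>) (at_left t)"
      by (intro tendsto_intros) (use assms in auto)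
    then show "(((\<lambda>s. exp (- \<alpha> * (t - s)) / \<alpha>) \<circ> real_of_ereal) \<longlongrightarrow> 1 / \<alpha>) (at_left (ereal t))"
      by (simp add: ereal_tendsto_simps)
  qed auto
  moreover have "einterval (- \<infinity>) (ereal t) = {..<t}" by (auto simp: einterval_def)
  ultimately have "integrable lborel (\<lambda>s. indicator {..<t} s * exp (- \<alpha> * (t - s)))"
    by (simp add: set_integrable_def)
  then show ?thesis
  proof (rule integrable_cong_AE_imp)
    show "AE s in lborel. indicator {..<t} s * exp (- \<alpha> * (t - s)) = indicator {..t} s * exp (- \<alpha> * (t - s))"
      using AE_lborel_singleton[of t] by eventually_elim (auto simp: indicator_def)
  qed simp
qed

text \<open>The real supremum in \<open>operator_norm\<close> is meaningful only for a bounded set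
  of quotients; the bound comes from the Euclidean operator norm and the equivalence of
  norms.\<close>

lemma vector_norm_le_operator_norm:
  fixes N :: "real ^ 'n \<Rightarrow> real"
  assumes vn: "vector_norm N"
  shows "N (B *v x) / N x \<le> operator_norm N B" and "N (B *v x) \<le> operator_norm N B * N x"
proof -
  obtain C1 where C1: "C1 > 0" "\<And>x. norm x \<le> C1 * N x" using norm_le_vector_norm[OF vn] by blast
  obtain C2 where C2: "C2 > 0" "\<And>x. N x \<le> C2 * norm x" using vector_norm_le_norm[OF vn] by blast
  have bdd: "N (B *v x) / N x \<le> C2 * (onorm ((*v) B) * C1)" for x
  proof (cases "x = 0")
    case False
    then have Nx: "N x > 0" using vector_norm_nonneg[OF vn, of x] vector_norm_zero[OF vn, of x] by linarith
    have "N (B *v x) \<le> C2 * norm (B *v x)" by (rule C2(2))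
    also have "\<dots> \<le> C2 * (onorm ((*v) B) * norm x)"
      using C2(1) by (intro mult_left_mono onorm matrix_vector_mul_bounded_linear) auto
    also have "\<dots> \<le> C2 * (onorm ((*v) B) * (C1 * N x))"
      using C1 C2(1) by (intro mult_left_mono onorm_pos_le matrix_vector_mul_bounded_linear) auto
    finally show ?thesis using Nx by (simp add: field_simps)
  qed (use C1(1) C2(1) onorm_pos_le[OF matrix_vector_mul_bounded_linear, of B] in
      \<open>auto simp: vector_norm_0[OF vn] intro!: mult_nonneg_nonneg\<close>)
  then show le: "N (B *v x) / N x \<le> operator_norm N B"
    unfolding operator_norm_def by (intro cSUP_upper) (auto simp: bdd_above_def)
  show "N (B *v x) \<le> operator_norm N B * N x"
  proof (cases "x = 0")
    case False
    then have Nx: "N x > 0" using vector_norm_nonneg[OF vn, of x] vector_norm_zero[OF vn, of x] by linarith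
    then show ?thesis using le by (simp add: pos_divide_le_eq)
  qed (simp add: vector_norm_0[OF vn])
qed

lemma C2_map_jacobian:
  fixes g :: "real ^ 'n \<Rightarrow> real ^ 'n"
  assumes "C2_map g"
  shows "(g has_derivative (\<lambda>h. jacobian g (at x) *v h)) (at x)"
    and "continuous_on UNIV (\<lambda>x. jacobian g (at x) *v v)"
proof -
  obtain g' where g': "\<And>x. (g has_derivative blinfun_apply (g' x)) (at x)" "C1_map g'"
    using assms unfolding C2_map_def by blast
  have J: "(g has_derivative (\<lambda>h. jacobian g (at x) *v h)) (at x)" for x
    using g'(1)[of x] jacobian_works unfolding differentiable_def by blast
  then show "(g has_derivative (\<lambda>h. jacobian g (at x) *v h)) (at x)" .
  have eq: "jacobian g (at x) *v v = blinfun_apply (g' x) v" for x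
    using has_derivative_unique[OF J g'(1), of x] by (rule fun_cong)
  have "continuous_on UNIV g'"
    using g'(2) unfolding C1_map_def by (metis continuous_at_imp_continuous_on has_derivative_continuous)
  then show "continuous_on UNIV (\<lambda>x. jacobian g (at x) *v v)"
    unfolding eq by (intro continuous_intros)
qed

section \<open>Transition matrices and uniqueness for the differential equations\<close>

locale contractive_system =
  fixes N :: "real ^ 'n \<Rightarrow> real"
    and A :: "real \<Rightarrow> real ^ 'n ^ 'n"
    and f :: "real \<Rightarrow> real ^ 'n \<Rightarrow> real ^ 'n"
    and \<Phi> :: "real \<Rightarrow> real ^ 'n ^ 'n"
    and y :: "real \<Rightarrow> real \<Rightarrow> real ^ 'n \<Rightarrow> real ^ 'n"
    and M \<mu> \<gamma> K \<alpha> :: real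
  assumes vn: "vector_norm N"
    and contf: "continuous_on UNIV (\<lambda>(t, x). f t x)"
    and fund: "fundamental_matrix A \<Phi>"
    and flow: "solution_flow (\<lambda>t x. A t *v x + f t x) y"
    and A_bound: "\<And>t. operator_norm N (A t) \<le> M"
    and f_bound: "\<And>t x. N (f t x) \<le> \<mu>"
    and f_lipschitz: "\<And>t x x'. N (f t x - f t x') \<le> \<gamma> * N (x - x')"
    and K_pos: "K > 0" and alpha_pos: "\<alpha> > 0"
    and dichotomy: "\<And>t s. s \<le> t \<Longrightarrow>
      operator_norm N (transition_matrix \<Phi> t s) \<le> K * exp (- \<alpha> * (t - s))"
    and f_C2: "\<And>t. C2_map (f t)"
    and kernel: "\<And>t. (\<integral>\<^sup>+ r \<in> {..t}. (SUP \<xi>. ennreal (operator_norm N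
        (transition_matrix \<Phi> t r ** jacobian (f r) (at (y r 0 \<xi>)) ** transition_matrix \<Phi> r t))) \<partial>lborel) < 1"
begin

abbreviation X where "X \<equiv> transition_matrix \<Phi>"

lemma Phi_derivative: "(\<Phi> has_vector_derivative A t ** \<Phi> t) (at t)" and Phi_invertible: "invertible (\<Phi> t)"
  using fund by (auto simp: fundamental_matrix_def)

lemma Phi_continuous: "continuous_on UNIV \<Phi>"
  by (intro continuous_at_imp_continuous_on ballI has_vector_derivative_continuous[OF Phi_derivative])

lemma X_vector: "X t s *v v = \<Phi> t *v (matrix_inv (\<Phi> s) *v v)"
  by (simp add: transition_matrix_def matrix_vector_mul_assoc)

lemma X_cancel: "X t s *v (X s t *v v) = v" and X_refl: "X t t *v v = v"
  by (simp_all add: X_vector matrix_inv_vector_cancel[OF Phi_invertible])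

lemma X_continuous:
  assumes "continuous_on UNIV u"
  shows "continuous_on UNIV (\<lambda>s. X t s *v u s)" and "continuous_on UNIV (\<lambda>s. X s t *v u s)"
  unfolding X_vector
  by (intro continuous_on_matrix_vector_mult continuous_on_const continuous_on_matrix_inv
      Phi_continuous Phi_invertible assms)+

text \<open>Product rule for leaving the moving frame: if \<open>u\<close> has derivative
  \<open>u'\<close>, then \<open>X r t *v u r\<close> solves the linear equation with forcing
  \<open>X r t *v u'\<close>.\<close>

lemma X_derivative:
  assumes "(u has_vector_derivative u') (at r)"
  shows "((\<lambda>r. X r t *v u r) has_vector_derivative A r *v (X r t *v u r) + X r t *v u') (at r)"
proof -
  have "((\<lambda>r. matrix_inv (\<Phi> t) *v u r) has_vector_derivative matrix_inv (\<Phi> t) *v u') (at r)"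
    by (rule bounded_linear.has_vector_derivative[OF matrix_vector_mul_bounded_linear assms])
  from bounded_bilinear.has_vector_derivative[OF bounded_bilinear_matrix_vector_mult Phi_derivative this]
  show ?thesis by (simp add: X_vector matrix_vector_mul_assoc matrix_mul_assoc add.commute)
qed

lemma f_continuous:
  assumes "continuous_on UNIV u"
  shows "continuous_on UNIV (\<lambda>s. f s (u s))"
proof -
  have "continuous_on UNIV (\<lambda>s. (s, u s))" by (intro continuous_intros assms)
  from continuous_on_compose2[OF contf this] show ?thesis by simp
qed

lemma y_derivative: "((\<lambda>t. y t \<tau> \<eta>) has_vector_derivative A t *v y t \<tau> \<eta> + f t (y t \<tau> \<eta>)) (at t)"
  and y_initial: "y \<tau> \<tau> \<eta> = \<eta>"
  using flow by (auto simp: solution_flow_def)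

lemma y_continuous: "continuous_on UNIV (\<lambda>t. y t \<tau> \<eta>)"
  by (intro continuous_at_imp_continuous_on ballI has_vector_derivative_continuous[OF y_derivative])

lemma vanishing:
  assumes cont: "continuous_on {a..b} w"
    and der: "\<And>s. a < s \<Longrightarrow> s < b \<Longrightarrow> (w has_vector_derivative w' s) (at s)"
    and le: "\<And>s. a < s \<Longrightarrow> s < b \<Longrightarrow> N (w' s) \<le> L * N (w s)" and L: "0 \<le> L"
    and zero: "w a = 0 \<or> w b = 0" and s: "a \<le> s" "s \<le> b"
  shows "w s = 0"
proof -
  obtain C1 where C1: "C1 > 0" "\<And>x. norm x \<le> C1 * N x" using norm_le_vector_norm[OF vn] by blast
  obtain C2 where C2: "C2 > 0" "\<And>x. N x \<le> C2 * norm x" using vector_norm_le_norm[OF vn] by blast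
  show ?thesis
  proof (rule vanishing_if_derivative_bounded_by_self[OF cont der _ zero s])
    fix s assume "a < s" "s < b"
    have "norm (w' s) \<le> C1 * N (w' s)" by (rule C1(2))
    also have "\<dots> \<le> C1 * (L * N (w s))"
      using C1(1) \<open>a < s\<close> \<open>s < b\<close> by (intro mult_left_mono le) auto
    also have "\<dots> \<le> C1 * (L * (C2 * norm (w s)))"
      using C1(1) C2(2) L by (intro mult_left_mono) auto
    finally show "norm (w' s) \<le> (C1 * L * C2) * norm (w s)" by (simp add: mult.assoc)
  qed
qed

lemma A_vector_norm: "N (A t *v v) \<le> M * N v"
  using vector_norm_le_operator_norm(2)[OF vn, of "A t" v]
    mult_right_mono[OF A_bound vector_norm_nonneg[OF vn, of v], of t] by linarith

lemma M_nonneg: "0 \<le> M" and gamma_nonneg: "0 \<le> \<gamma>"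
proof -
  obtain v :: "real ^ 'n" where "v \<noteq> 0" using axis_eq_0_iff[of _ "1::real"] zero_neq_one by blast
  then have v: "N v > 0" using vector_norm_nonneg[OF vn, of v] vector_norm_zero[OF vn, of v] by linarith
  have "0 \<le> M * N v" using A_vector_norm vector_norm_nonneg[OF vn] order_trans by blast
  then show "0 \<le> M" using v by (simp add: zero_le_mult_iff)
  have "0 \<le> \<gamma> * N (v - 0)" using f_lipschitz vector_norm_nonneg[OF vn] order_trans by blast
  then show "0 \<le> \<gamma>" using v by (simp add: zero_le_mult_iff)
qed

text \<open>The difference of two solutions has derivative bounded by \<open>M + \<gamma>\<close>
  times itself. Agreement may be given at either endpoint, so that solutions can be followed in both
  time directions.\<close>

lemma flow_unique:
  assumes cont: "continuous_on {a..b} z"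
    and der: "\<And>s. a < s \<Longrightarrow> s < b \<Longrightarrow> (z has_vector_derivative A s *v z s + f s (z s)) (at s)"
    and eq: "z a = y a \<tau> \<eta> \<or> z b = y b \<tau> \<eta>" and s: "a \<le> s" "s \<le> b"
  shows "z s = y s \<tau> \<eta>"
proof -
  have "z s - y s \<tau> \<eta> = 0"
  proof (rule vanishing[where w = "\<lambda>s. z s - y s \<tau> \<eta>" and L = "M + \<gamma>"])
    show "continuous_on {a..b} (\<lambda>s. z s - y s \<tau> \<eta>)"
      by (intro continuous_on_diff cont continuous_on_subset[OF y_continuous]) simp
    fix s assume s: "a < s" "s < b"
    show "((\<lambda>s. z s - y s \<tau> \<eta>) has_vector_derivative
        (A s *v z s + f s (z s)) - (A s *v y s \<tau> \<eta> + f s (y s \<tau> \<eta>))) (at s)"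
      by (intro has_vector_derivative_diff der s y_derivative)
    have "(A s *v z s + f s (z s)) - (A s *v y s \<tau> \<eta> + f s (y s \<tau> \<eta>)) =
        A s *v (z s - y s \<tau> \<eta>) + (f s (z s) - f s (y s \<tau> \<eta>))"
      by (simp add: matrix_vector_mult_diff_distrib)
    then have "N ((A s *v z s + f s (z s)) - (A s *v y s \<tau> \<eta> + f s (y s \<tau> \<eta>))) \<le>
        N (A s *v (z s - y s \<tau> \<eta>)) + N (f s (z s) - f s (y s \<tau> \<eta>))"
      using vector_norm_triangle[OF vn] by metis
    then show "N ((A s *v z s + f s (z s)) - (A s *v y s \<tau> \<eta> + f s (y s \<tau> \<eta>))) \<le> (M + \<gamma>) * N (z s - y s \<tau> \<eta>)"
      using A_vector_norm[of s "z s - y s \<tau> \<eta>"] f_lipschitz[of s "z s" "y s \<tau> \<eta>"]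
      by (simp add: distrib_right)
  qed (use M_nonneg gamma_nonneg eq s in auto)
  then show ?thesis by simp
qed

text \<open>Every point at time \<open>r\<close> lies on a trajectory parametrised by its value at
  time 0. Hence the supremum over \<xi> in the kernel hypothesis is one over all of space.\<close>

lemma y_0_surjective: "y r 0 (y 0 r x) = x"
proof -
  have "y r r x = y r 0 (y 0 r x)"
  proof (rule flow_unique[where z = "\<lambda>s. y s r x" and a = "min 0 r" and b = "max 0 r"])
    show "y (min 0 r) r x = y (min 0 r) 0 (y 0 r x) \<or> y (max 0 r) r x = y (max 0 r) 0 (y 0 r x)"
      by (cases "0 \<le> r") (auto simp: y_initial min_def max_def)
  qed (use y_derivative continuous_on_subset[OF y_continuous] in auto)
  then show ?thesis by (simp add: y_initial)
qed

section \<open>The moving frame on the half-line up to a fixed time\<close>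

context
  fixes t :: real
begin

text \<open>The nonlinearity in the frame that makes the linear flow constant. The cut-off extends
  the equation to the whole line: its solutions stay constant after time \<open>t\<close>.\<close>

definition F :: "real \<Rightarrow> real ^ 'n \<Rightarrow> real ^ 'n" where
  "F s x = indicator {..t} s *\<^sub>R (X t s *v f s (X s t *v x))"

definition D :: "real \<Rightarrow> real ^ 'n \<Rightarrow> real ^ 'n \<Rightarrow> real ^ 'n" where
  "D s x v = indicator {..t} s *\<^sub>R (X t s *v (jacobian (f s) (at (X s t *v x)) *v (X s t *v v)))"

text \<open>The dichotomy makes the integrand decay exponentially towards -\<infinity>, uniformly
  over forcings bounded by \<mu>.\<close>

lemma forcing_integrable:
  assumes "continuous_on UNIV h" "\<And>s. N (h s) \<le> \<mu>"
  shows "integrable lborel (\<lambda>s. indicator {..t} s *\<^sub>R (X t s *v h s))"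
proof -
  obtain C1 where C1: "C1 > 0" "\<And>x. norm x \<le> C1 * N x" using norm_le_vector_norm[OF vn] by blast
  have "integrable lborel (\<lambda>s. C1 * K * \<mu> * (indicator {..t} s * exp (- \<alpha> * (t - s))))"
    by (intro integrable_mult_right integrable_exp_decay alpha_pos)
  then show ?thesis
  proof (rule Bochner_Integration.integrable_bound)
    show "(\<lambda>s. indicator {..t} s *\<^sub>R (X t s *v h s)) \<in> borel_measurable lborel"
      using borel_measurable_continuous_onI[OF X_continuous(1)[OF assms(1)]] by simp
    have "norm (X t s *v h s) \<le> \<bar>C1 * K * \<mu> * exp (- \<alpha> * (t - s))\<bar>" if "s \<le> t" for s
    proof -
      have "norm (X t s *v h s) \<le> C1 * N (X t s *v h s)" by (rule C1(2))
      also have "\<dots> \<le> C1 * (operator_norm N (X t s) * N (h s))"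
        using C1(1) by (intro mult_left_mono vector_norm_le_operator_norm[OF vn]) simp
      also have "\<dots> \<le> C1 * ((K * exp (- \<alpha> * (t - s))) * \<mu>)"
        using C1(1) K_pos by (intro mult_left_mono mult_mono dichotomy that assms(2) vector_norm_nonneg[OF vn]) auto
      also have "\<dots> = C1 * K * \<mu> * exp (- \<alpha> * (t - s))" by simp
      finally show ?thesis by linarith
    qed
    then show "AE s in lborel. norm (indicator {..t} s *\<^sub>R (X t s *v h s)) \<le>
        norm (C1 * K * \<mu> * (indicator {..t} s * exp (- \<alpha> * (t - s))))"
      by (auto simp: indicator_def)
  qed
qed

text \<open>Inside the frame \<open>u\<close> has derivative \<open>X t r *v h r\<close>; leaving
  the frame cancels this transition matrix and restores the linear term. The condition
  \<open>r < t\<close> keeps away from the jump of the cut-off.\<close>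

lemma forced_derivative:
  assumes "continuous_on UNIV h" "\<And>s. N (h s) \<le> \<mu>" "r < t"
    and "\<And>r. u r = c + (LINT s:{..r}|lborel. indicator {..t} s *\<^sub>R (X t s *v h s))"
  shows "((\<lambda>r. X r t *v u r) has_vector_derivative A r *v (X r t *v u r) + h r) (at r)"
proof -
  let ?g = "\<lambda>s. indicator {..t} s *\<^sub>R (X t s *v h s)"
  \<comment> \<open>Any interval around \<open>r\<close> that ends at \<open>t\<close> would do; on
    it the indicator is 1.\<close>
  have "continuous_on {r - 1..t} (\<lambda>s. X t s *v h s)"
    by (rule continuous_on_subset[OF X_continuous(1)[OF assms(1)]]) simp
  then have "continuous_on {r - 1..t} ?g"
    by (rule continuous_on_eq) simp
  from LINT_atMost_has_vector_derivative[OF forcing_integrable[OF assms(1,2)] this _ assms(3)]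
  have "((\<lambda>r. c + (LINT s:{..r}|lborel. ?g s)) has_vector_derivative 0 + ?g r) (at r)"
    by (intro has_vector_derivative_add has_vector_derivative_const) simp
  moreover have "u = (\<lambda>r. c + (LINT s:{..r}|lborel. ?g s))" using assms(4) by blast
  ultimately have "(u has_vector_derivative X t r *v h r) (at r)" using assms(3) by simp
  from X_derivative[OF this, of t] show ?thesis by (simp add: X_cancel)
qed

lemma F_derivative: "(F s has_derivative D s x) (at x)"
proof -
  have lin: "((\<lambda>x. B *v x) has_derivative (\<lambda>x. B *v x)) G" for B :: "real ^ 'n ^ 'n" and G
    by (rule bounded_linear.has_derivative[OF matrix_vector_mul_bounded_linear has_derivative_ident])
  have "((\<lambda>x. f s (X s t *v x)) has_derivative (\<lambda>v. jacobian (f s) (at (X s t *v x)) *v (X s t *v v))) (at x)"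
    by (rule has_derivative_compose[OF lin C2_map_jacobian(1)[OF f_C2]])
  then show ?thesis unfolding F_def D_def
    by (intro has_derivative_scaleR_right bounded_linear.has_derivative[OF matrix_vector_mul_bounded_linear])
qed

lemma F_measurable:
  assumes "continuous_on UNIV u"
  shows "(\<lambda>s. F s (u s)) \<in> borel_measurable borel"
  unfolding F_def
  using borel_measurable_continuous_onI[OF X_continuous(1)[OF f_continuous[OF X_continuous(2)[OF assms]]]]
  by simp

lemma F_integrable_0: "integrable lborel (\<lambda>s. F s 0)"
  unfolding F_def by (intro forcing_integrable f_bound f_continuous X_continuous continuous_on_const)

lemma D_continuous: "continuous_on UNIV (\<lambda>x. D s x v)"
  unfolding D_def
proof (rule continuous_on_scaleR[OF continuous_on_const continuous_on_matrix_vector_mult[OF continuous_on_const]])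
  have "continuous_on UNIV (\<lambda>x. X s t *v x)"
    by (intro continuous_on_matrix_vector_mult continuous_on_const continuous_on_id)
  from continuous_on_compose2[OF C2_map_jacobian(2)[OF f_C2] this]
  show "continuous_on UNIV (\<lambda>x. jacobian (f s) (at (X s t *v x)) *v (X s t *v v))" by simp
qed

text \<open>\<open>D s x\<close> is the conjugated Jacobian of the kernel hypothesis at the
  trajectory with \<xi> = \<open>y 0 s (X s t *v x)\<close>, so the integrand there dominates all
  its quotients.\<close>

lemma kernel_exists: "\<exists>\<beta>. contractive_matrix_kernel N \<beta> F D"
proof -
  have "(\<lambda>s. D s x v) \<in> borel_measurable borel" for x v
    by (rule borel_measurable_directional_derivative[OF F_measurable F_derivative
          continuous_on_const continuous_on_const])
  moreover have "linear (D s x)" for s x by (rule has_derivative_linear[OF F_derivative])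
  moreover let ?h = "\<lambda>s. (SUP \<xi>. ennreal (operator_norm N
        (X t s ** jacobian (f s) (at (y s 0 \<xi>)) ** X s t))) * indicator {..t} s"
  have "ennreal (N (D s x v) / N v) \<le> ?h s" for s x v
  proof (cases "s \<le> t")
    case True
    have "N (D s x v) / N v \<le> operator_norm N (X t s ** jacobian (f s) (at (y s 0 (y 0 s (X s t *v x)))) ** X s t)"
      using vector_norm_le_operator_norm(1)[OF vn,
          of "X t s ** jacobian (f s) (at (y s 0 (y 0 s (X s t *v x)))) ** X s t" v] True
      by (simp add: D_def y_0_surjective matrix_vector_mul_assoc matrix_mul_assoc)
    then have "ennreal (N (D s x v) / N v) \<le> (SUP \<xi>. ennreal (operator_norm N
        (X t s ** jacobian (f s) (at (y s 0 \<xi>)) ** X s t)))"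
      by (intro SUP_upper2[of "y 0 s (X s t *v x)"] ennreal_leI) auto
    then show ?thesis using True by simp
  qed (simp add: D_def vector_norm_0[OF vn])
  ultimately obtain \<beta> where "integrable lborel \<beta>" "\<And>s. 0 \<le> \<beta> s" "(\<integral>s. \<beta> s \<partial>lborel) < 1"
    "AE s in lborel. \<forall>x v. N (D s x v) \<le> \<beta> s * N v"
    using countable_kernel_bound[OF vn, of D ?h] D_continuous kernel[of t] by blast
  then have "contractive_matrix_kernel N \<beta> F D"
    by unfold_locales (use vn F_measurable F_integrable_0 F_derivative D_continuous in auto)
  then show ?thesis by blast
qed

text \<open>It remains to see that the linearization map and \<open>\<lambda>c. solution c t\<close>
  are mutually inverse, by passing between trajectories of the nonlinear system and solutions of the
  integral equation.\<close>

lemma linearization_map_orientation_preserving: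
  "orientation_preserving_diffeomorphism (linearization_map \<Phi> f y t)"
proof -
  obtain \<beta> where "contractive_matrix_kernel N \<beta> F D" using kernel_exists by blast
  then interpret contractive_matrix_kernel N \<beta> F D .
  let ?G = "linearization_map \<Phi> f y t"
  let ?i = "indicator {..t} :: real \<Rightarrow> real"
  have G: "?G \<eta> = \<eta> - (LINT s:{..t}|lborel. ?i s *\<^sub>R (X t s *v f s (y s t \<eta>)))" for \<eta>
  proof -
    have "(LINT s:{..t}|lborel. ?i s *\<^sub>R (X t s *v f s (y s t \<eta>))) = (LINT s:{..t}|lborel. X t s *v f s (y s t \<eta>))"
      by (rule set_lebesgue_integral_cong) auto
    then show ?thesis by (simp add: linearization_map_def)
  qed
  show ?thesis
  proof (rule inverse_of_solution_orientation_preserving)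
    fix c
    let ?u = "solution c"
    have ht: "continuous_on UNIV (\<lambda>s. f s (X s t *v ?u s))"
      by (intro f_continuous X_continuous solution_continuous)
    \<comment> \<open>Out of the frame, \<open>?u\<close> solves the nonlinear equation before
      \<open>t\<close> and has value \<open>?u t\<close> at \<open>t\<close>. It is therefore the
      trajectory in the linearization map, whose integral is then the one in the equation for
      \<open>?u\<close>.\<close>
    have yz: "X s t *v ?u s = y s t (?u t)" if "s \<le> t" for s
    proof (rule flow_unique[where z = "\<lambda>s. X s t *v ?u s" and a = s and b = t])
      show "continuous_on {s..t} (\<lambda>s. X s t *v ?u s)"
        by (rule continuous_on_subset[OF X_continuous(2)[OF solution_continuous]]) simp
      show "((\<lambda>s. X s t *v ?u s) has_vector_derivative A r *v (X r t *v ?u r) + f r (X r t *v ?u r)) (at r)"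
        if "s < r" "r < t" for r
        by (rule forced_derivative[OF ht f_bound \<open>r < t\<close>]) (rule trans[OF solution_eq], simp only: F_def)
    qed (use that in \<open>auto simp: X_refl y_initial\<close>)
    have "(LINT s:{..t}|lborel. ?i s *\<^sub>R (X t s *v f s (y s t (?u t)))) = (LINT s:{..t}|lborel. F s (?u s))"
      by (rule set_lebesgue_integral_cong) (auto simp: F_def yz)
    then have "?G (?u t) = ?u t - (LINT s:{..t}|lborel. F s (?u s))" by (simp only: G)
    also have "\<dots> = c" by (simp add: diff_eq_eq solution_eq[symmetric])
    finally show "?G (?u t) = c" .
  next
    fix \<eta>
    let ?g = "\<lambda>s. ?i s *\<^sub>R (X t s *v f s (y s t \<eta>))"
    \<comment> \<open>Conversely, the forcing along the given trajectory is integrated from the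
      value \<open>?G \<eta>\<close> at -\<infinity>; the definition of the linearization map gives
      \<open>u t = \<eta>\<close>.\<close>
    define u where "u = (\<lambda>r. ?G \<eta> + (LINT s:{..r}|lborel. ?g s))"
    have ht: "continuous_on UNIV (\<lambda>s. f s (y s t \<eta>))" by (intro f_continuous y_continuous)
    have int: "integrable lborel ?g" by (rule forcing_integrable[OF ht f_bound])
    have ut: "u t = \<eta>" by (simp add: u_def G)
    have uc: "continuous_on UNIV u" unfolding u_def
      by (intro continuous_on_add continuous_on_const continuous_on_LINT_atMost int)
    \<comment> \<open>Both curves solve the linear equation with the same forcing and agree at
      \<open>t\<close>, so the difference solves the homogeneous equation. Hence \<open>u\<close>
      satisfies the nonlinear integral equation.\<close>
    have z: "X s t *v u s - y s t \<eta> = 0" if "s \<le> t" for s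
    proof (rule vanishing[where w = "\<lambda>s. X s t *v u s - y s t \<eta>" and L = M and a = s and b = t])
      show "continuous_on {s..t} (\<lambda>s. X s t *v u s - y s t \<eta>)"
        by (rule continuous_on_subset[OF continuous_on_diff[OF X_continuous(2)[OF uc] y_continuous]]) simp
      fix r assume "s < r" "r < t"
      have "((\<lambda>r. X r t *v u r) has_vector_derivative A r *v (X r t *v u r) + f r (y r t \<eta>)) (at r)"
        by (rule forced_derivative[OF ht f_bound \<open>r < t\<close>]) (simp add: u_def)
      from has_vector_derivative_diff[OF this y_derivative[of t \<eta>]]
      show "((\<lambda>s. X s t *v u s - y s t \<eta>) has_vector_derivative A r *v (X r t *v u r - y r t \<eta>)) (at r)"
        by (simp add: matrix_vector_mult_diff_distrib)
    qed (use that M_nonneg A_vector_norm in \<open>auto simp: X_refl y_initial ut\<close>)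
    have Fu: "F s (u s) = ?g s" for s
      using z[of s] by (cases "s \<le> t") (simp_all add: F_def)
    have "solves_from_bot F (?G \<eta>) u"
      unfolding solves_from_bot_def Fu
    proof (intro conjI allI uc)
      show "bounded (range u)" unfolding u_def by (rule bounded_LINT_atMost[OF int])
    qed (simp add: u_def)
    then have "solution (?G \<eta>) = u" by (rule solves_from_bot_unique[OF F_admissible solution])
    then show "solution (?G \<eta>) t = \<eta>" by (simp add: ut)
  qed
qed

end

end

theorem theorem2p1:
  fixes N :: "real ^ 'n \<Rightarrow> real"
    and A :: "real \<Rightarrow> real ^ 'n ^ 'n"
    and f :: "real \<Rightarrow> real ^ 'n \<Rightarrow> real ^ 'n"
    and \<Phi> :: "real \<Rightarrow> real ^ 'n ^ 'n"
    and y :: "real \<Rightarrow> real \<Rightarrow> real ^ 'n \<Rightarrow> real ^ 'n"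
    and M \<mu> \<gamma> K \<alpha> :: real
  assumes norm: "vector_norm N"
    and contA: "continuous_on UNIV A"
    and contf: "continuous_on UNIV (\<lambda>(t, x). f t x)"
    and fund: "fundamental_matrix A \<Phi>"
    and flow: "solution_flow (\<lambda>t x. A t *v x + f t x) y"
    and A1: "bdd_above (range (\<lambda>t. operator_norm N (A t)))"
            "(SUP t. operator_norm N (A t)) = M"
    and A2: "\<mu> > 0" "\<And>t x. N (f t x) \<le> \<mu>"
    and A3: "\<gamma> > 0" "\<And>t x x'. N (f t x - f t x') \<le> \<gamma> * N (x - x')"
    and A4: "K > 0" "\<alpha> > 0"
            "\<And>t s. s \<le> t \<Longrightarrow>
               operator_norm N (transition_matrix \<Phi> t s) \<le> K * exp (- \<alpha> * (t - s))"
            "2 * K * \<gamma> < \<alpha>"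
    and D1: "\<And>t. C2_map (f t)"
            "\<And>t. (\<integral>\<^sup>+ r \<in> {..t}.
                (SUP \<xi>. ennreal (operator_norm N
                   (transition_matrix \<Phi> t r ** jacobian (f r) (at (y r 0 \<xi>))
                      ** transition_matrix \<Phi> r t))) \<partial>lborel) < 1"
    and D2: "\<And>t \<xi>. \<exists>L < \<infinity>.
               has_improper_integral_upto (\<lambda>r. trace (jacobian (f r) (at (y r t \<xi>)))) t L"
  shows "\<forall>t. orientation_preserving_diffeomorphism (\<lambda>\<eta>. linearization_map \<Phi> f y t \<eta>)"
proof -
  have "operator_norm N (A t) \<le> M" for t
    using cSUP_upper[OF UNIV_I A1(1)] A1(2) by simp
  then interpret contractive_system N A f \<Phi> y M \<mu> \<gamma> K \<alpha>
    by unfold_locales (use assms in auto)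
  show ?thesis using linearization_map_orientation_preserving by blast
qed

end
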